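(* Let $\{\mu_n\}_{n=1}^{\infty}$ be a sequence of Borel probability measures on $\mathbb{R}$ with finite variances $\mathrm{var}(\mu_n)$. Suppose that there is a sequence $\{b_n\}_{n=1}^{\infty}$ of real numbers with $0<b_1<b_2<\cdots$ and $b_n\to\infty$ such that $$\sum_{k=1}^{\infty}\frac{\mathrm{var}(\mu_k)}{b_k^{2}}<\infty .$$ Then the sequence of probability measures $$\nu_n = D_{1/b_n}(\mu_1\triangleright\mu_2\triangleright\cdots\triangleright\mu_n),\qquad n\ge 1,$$ is stable; that is, there exist constants $a_n\in\mathbb{R}$ such that for every $\varepsilon>0$, $$\lim_{n\to\infty}\nu_n\big(\{t\in\mathbb{R}: |t-a_n|\ge\varepsilon\}\big)=0 .$$
   Context: Let $\mathcal{M}$ be the set of all Borel probability measures on $\mathbb{R}$, and let $\mathbb{C}^+=\{z\in\mathbb{C}:\Im z>0\}$. For $\mu\in\mathcal{M}$, the Cauchy transform is $G_\mu(z)=\int_{-\infty}^{\infty}\frac{1}{z-t}\,\mu(dt)$ for $z\in\mathbb{C}^+$, and $F_\mu(z)=1/G_\mu(z)$, which is an analytic map from $\mathbb{C}^+$ to $\mathbb{C}^+$. The monotone convolution $\triangleright$ is the associative binary operation on $\mathcal{M}$ characterized as follows: for $\mu,\nu\in\mathcal{M}$, $\mu\triangleright\nu$ is the unique element of $\mathcal{M}$ such that $F_{\mu\triangleright\nu}(z)=F_\mu(F_\nu(z))$ for all $z\in\mathbb{C}^+$. (Equivalently, $\mu\triangleright\nu$ is the distribution of $X+Y$ where $X,Y$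 are monotonically independent non-commutative random variables with distributions $\mu$ and $\nu$, respectively.) For $n=1$ the expression $\mu_1\triangleright\cdots\triangleright\mu_n$ means $\mu_1$. For $b>0$ and $\mu\in\mathcal{M}$, the dilation $D_b\mu$ is the measure defined by $D_b\mu(A)=\mu(b^{-1}A)$ for Borel sets $A\subset\mathbb{R}$. *)

theory Defs
  imports "HOL-Probability.Probability"
begin

definition cauchy_transform :: "real measure \<Rightarrow> complex \<Rightarrow> complex" where
  "cauchy_transform \<mu> z = (LINT t|\<mu>. 1 / (z - complex_of_real t))"

definition reciprocal_cauchy_transform :: "real measure \<Rightarrow> complex \<Rightarrow> complex" where
  "reciprocal_cauchy_transform \<mu> z = 1 / cauchy_transform \<mu> z"

definition monotone_convolution :: "real measure \<Rightarrow> real measure \<Rightarrow> real measure"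
    (infixl \<open>\<triangleright>\<close> 70) where
  "\<mu> \<triangleright> \<nu> = (THE \<rho>. real_distribution \<rho> \<and>
     (\<forall>z. Im z > 0 \<longrightarrow>
        reciprocal_cauchy_transform \<rho> z =
        reciprocal_cauchy_transform \<mu> (reciprocal_cauchy_transform \<nu> z)))"

text \<open>
  The \<open>n\<close>-fold convolution of \<open>\<mu> 1, \<dots>, \<mu> n\<close>, bracketed to the left.  The value at \<open>0\<close> is the
  unit of monotone convolution.
\<close>
fun monotone_convolution_upto :: "(nat \<Rightarrow> real measure) \<Rightarrow> nat \<Rightarrow> real measure" where
  "monotone_convolution_upto \<mu> 0 = return borel 0"
| "monotone_convolution_upto \<mu> (Suc 0) = \<mu> 1"
| "monotone_convolution_upto \<mu> (Suc (Suc n)) =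
     monotone_convolution_upto \<mu> (Suc n) \<triangleright> \<mu> (Suc (Suc n))"

text \<open>For \<open>b > 0\<close> the preimage of \<open>A\<close> under \<open>x \<mapsto> b * x\<close> is \<open>b\<inverse> A\<close>.\<close>
definition dilation :: "real \<Rightarrow> real measure \<Rightarrow> real measure" where
  "dilation b \<mu> = distr \<mu> borel (\<lambda>x. b * x)"

text \<open>
  The Bochner integral is \<open>0\<close> on non-integrable functions, so finiteness of the variance has to be
  stated through integrability.
\<close>
definition finite_variance :: "real measure \<Rightarrow> bool" where
  "finite_variance \<mu> \<longleftrightarrow>
     integrable \<mu> (\<lambda>x. x) \<and> integrable \<mu> (\<lambda>x. (x - (LINT y|\<mu>. y))\<^sup>2)"

definition stable_sequence :: "(nat \<Rightarrow> real measure) \<Rightarrow> bool" where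
  "stable_sequence \<nu> \<longleftrightarrow>
     (\<exists>a :: nat \<Rightarrow> real. \<forall>\<epsilon>>0. (\<lambda>n. measure (\<nu> n) {t. \<bar>t - a n\<bar> \<ge> \<epsilon>}) \<longlonglongrightarrow> 0)"

end

theory Submission
  imports Defs "HOL-Complex_Analysis.Complex_Analysis" "HOL-Real_Asymp.Real_Asymp"
begin

text \<open>
  Variances are additive under monotone convolution.  With \<open>u = G\<^sub>\<nu>(z)\<close> and \<open>w = F\<^sub>\<nu>(z) = 1 / u\<close>, the
  expansion \<open>w G\<^sub>\<mu>(w) = 1 + m / w + (s + o(1)) / w\<^sup>2\<close> and the analogous one for \<open>\<nu>\<close> give the expansion of
  \<open>G\<^sub>\<mu>(F\<^sub>\<nu>(z))\<close> along the imaginary axis, from which the first two moments of \<open>\<mu> \<triangleright> \<nu>\<close> are read off.  So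
  \<open>\<nu>\<^sub>n\<close> has variance \<open>(\<Sum>k\<le>n. var \<mu>\<^sub>k) / b\<^sub>n\<^sup>2\<close>, which tends to \<open>0\<close> by Kronecker's lemma, and
  Chebyshev's inequality gives stability with \<open>a\<^sub>n\<close> the mean of \<open>\<nu>\<^sub>n\<close>.

  For \<open>\<mu> \<triangleright> \<nu>\<close> to be meaningful, \<open>G\<^sub>\<mu> \<circ> F\<^sub>\<nu>\<close> must be the Cauchy transform of exactly one measure.
  Uniqueness is Stieltjes inversion in terms of characteristic functions.  For existence, Cauchy's
  formula on the half-plane shows that \<open>G(\<cdot> + i \<epsilon>)\<close> is the transform of the density
  \<open>- Im G(t + i \<epsilon>) / \<pi>\<close>; these measures are tight, and a weak limit as \<open>\<epsilon> \<rightarrow> 0\<close> has transform \<open>G\<close>.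
\<close>

section \<open>The Cauchy transform\<close>

lemma Im_le_norm_diff_of_real: "Im z \<le> norm (z - complex_of_real t)"
  using abs_Im_le_cmod[of "z - of_real t"] by simp

lemma diff_of_real_nonzero: "Im z > 0 \<Longrightarrow> z - complex_of_real t \<noteq> 0"
  using Im_le_norm_diff_of_real[of z t] by auto

lemma norm_resolvent_le: "Im z > 0 \<Longrightarrow> norm (1 / (z - complex_of_real t)) \<le> 1 / Im z"
  using Im_le_norm_diff_of_real[of z t] by (simp add: norm_divide frac_le)

lemma Im_resolvent: "Im (1 / (z - complex_of_real t)) = - (Im z * (norm (1 / (z - of_real t)))\<^sup>2)"
  by (simp add: Im_divide norm_divide cmod_power2 power_divide)

context real_distribution
begin

lemma integrable_resolvent:
  assumes "Im z > 0"
  shows "integrable M (\<lambda>t. 1 / (z - of_real t))"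
  by (rule integrable_const_bound[where B = "1 / Im z"]) (use assms norm_resolvent_le in auto)

text \<open>The difference quotient is compared directly with the expected derivative: the resolvent
  identity collapses the error to the integral of \<open>(w - z) * (?r w t * (?r z t)^2)\<close>,
  which is of order \<open>norm (w - z)\<close>.\<close>

lemma cauchy_transform_holomorphic: "cauchy_transform M holomorphic_on {z. Im z > 0}"
proof -
  have "(cauchy_transform M has_field_derivative - (LINT t|M. (1 / (z - of_real t))\<^sup>2)) (at z)"
    if z: "Im z > 0" for z
  proof -
    \<comment> \<open>Points within \<open>d\<close> of \<open>z\<close> still have imaginary part
      above \<open>d\<close>, so both resolvents are bounded by \<open>1 / d\<close> uniformly in
      \<open>t\<close>.\<close>
    define d where "d = Im z / 2"
    have d: "d > 0" using z by (simp add: d_def)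
    let ?r = "\<lambda>z t. 1 / (z - complex_of_real t)"
    have bnd: "norm ((cauchy_transform M w - cauchy_transform M z) / (w - z)
        - - (LINT t|M. (?r z t)\<^sup>2)) \<le> norm (w - z) / d ^ 3"
      if w: "dist w z < d" "w \<noteq> z" for w
    proof -
      have "\<bar>Im w - Im z\<bar> < d"
        using w abs_Im_le_cmod[of "w - z"] by (simp add: dist_norm)
      then have Imw: "Im w > d" and Imz: "Im z > d"
        using z unfolding d_def by (simp_all only: abs_less_iff) linarith+
      have rw: "norm (?r w t) \<le> 1 / d" and rz: "norm (?r z t) \<le> 1 / d" for t
        using norm_resolvent_le[of w t] norm_resolvent_le[of z t] Imw Imz d
        by (auto intro: order_trans[OF _ frac_le[of 1 1 d]])
      have I2: "integrable M (\<lambda>t. (?r z t)\<^sup>2)"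
        by (rule integrable_const_bound[where B = "(1 / d)\<^sup>2"])
           (use rz in \<open>auto simp del: norm_divide simp: norm_power intro!: power_mono\<close>)
      have I: "integrable M (?r w)" "integrable M (?r z)"
        using integrable_resolvent Imw Imz d by auto
      have "(cauchy_transform M w - cauchy_transform M z) / (w - z) - - (LINT t|M. (?r z t)\<^sup>2)
          = (LINT t|M. (?r w t - ?r z t) / (w - z) + (?r z t)\<^sup>2)"
        using I I2 by (simp add: cauchy_transform_def)
      also have "\<dots> = (LINT t|M. (w - z) * (?r w t * (?r z t)\<^sup>2))"
      proof (rule Bochner_Integration.integral_cong[OF refl])
        fix t
        have "w - of_real t \<noteq> 0" "z - of_real t \<noteq> 0" "w - z \<noteq> 0"
          using w Imw Imz d diff_of_real_nonzero[of w t] diff_of_real_nonzero[of z t] by auto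
        then show "(?r w t - ?r z t) / (w - z) + (?r z t)\<^sup>2 = (w - z) * (?r w t * (?r z t)\<^sup>2)"
          by (simp add: divide_simps power2_eq_square) (simp add: algebra_simps)
      qed
      also have "norm \<dots> \<le> (LINT t|M. norm (w - z) / d ^ 3)"
      proof (rule order_trans[OF integral_norm_bound integral_mono[OF integrable_norm integrable_const]])
        have b: "norm ((w - z) * (?r w t * (?r z t)\<^sup>2)) \<le> norm (w - z) / d ^ 3" for t
        proof -
          have "norm (?r w t * (?r z t)\<^sup>2) \<le> (1 / d) * (1 / d)\<^sup>2"
            unfolding norm_mult norm_power using rw rz d by (intro mult_mono power_mono) auto
          then have "norm (w - z) * norm (?r w t * (?r z t)\<^sup>2) \<le> norm (w - z) * ((1 / d) * (1 / d)\<^sup>2)"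
            by (intro mult_left_mono) auto
          then show ?thesis by (simp only: norm_mult) (simp add: power2_eq_square power3_eq_cube)
        qed
        then show "\<And>t. norm ((w - z) * (?r w t * (?r z t)\<^sup>2)) \<le> norm (w - z) / d ^ 3" .
        show "integrable M (\<lambda>t. (w - z) * (?r w t * (?r z t)\<^sup>2))"
          by (rule integrable_const_bound[where B = "norm (w - z) / d ^ 3"]) (use b in auto)
      qed
      finally show ?thesis by (simp add: prob_space[simplified])
    qed
    show ?thesis
      unfolding has_field_derivative_iff
    proof (subst LIM_zero_iff[symmetric], rule Lim_null_comparison)
      show "\<forall>\<^sub>F w in at z. norm ((cauchy_transform M w - cauchy_transform M z) / (w - z)
        - - (LINT t|M. (?r z t)\<^sup>2)) \<le> norm (w - z) / d ^ 3"
        unfolding eventually_at using bnd d by blast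
      show "((\<lambda>w. norm (w - z) / d ^ 3) \<longlongrightarrow> 0) (at z)"
        using d by (auto intro!: tendsto_eq_intros)
    qed
  qed
  then show ?thesis
    by (subst holomorphic_on_open) (auto simp: open_halfspace_Im_gt)
qed

lemma Im_cauchy_transform:
  assumes "Im z > 0"
  shows "Im (cauchy_transform M z) = - (Im z * (LINT t|M. (norm (1 / (z - of_real t)))\<^sup>2))"
proof -
  have "Im (cauchy_transform M z) = (LINT t|M. Im (1 / (z - of_real t)))"
    unfolding cauchy_transform_def using integrable_resolvent[OF assms] by (simp add: integral_Im)
  also have "\<dots> = - (Im z * (LINT t|M. (norm (1 / (z - of_real t)))\<^sup>2))"
    by (simp only: Im_resolvent integral_minus integral_mult_right_zero)
  finally show ?thesis .
qed

text \<open>Jensen's inequality for the square, applied to real and imaginary parts separately in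
  the form that a variance is nonnegative.\<close>

lemma norm_cauchy_transform_sq_le:
  assumes z: "Im z > 0"
  shows "(norm (cauchy_transform M z))\<^sup>2 \<le> (LINT t|M. (norm (1 / (z - of_real t)))\<^sup>2)"
proof -
  let ?r = "\<lambda>t. 1 / (z - complex_of_real t)"
  have I: "integrable M ?r" using integrable_resolvent[OF z] .
  have b: "\<bar>Re (?r t)\<bar> \<le> 1 / Im z" "\<bar>Im (?r t)\<bar> \<le> 1 / Im z" for t
    using norm_resolvent_le[OF z, of t] abs_Re_le_cmod[of "?r t"] abs_Im_le_cmod[of "?r t"] by linarith+
  have I2: "integrable M (\<lambda>t. (Re (?r t))\<^sup>2)" "integrable M (\<lambda>t. (Im (?r t))\<^sup>2)"
    using power_mono[OF b(1), of _ 2] power_mono[OF b(2), of _ 2]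
    by (auto intro!: integrable_const_bound[where B = "(1 / Im z)\<^sup>2"])
  have "(Re (cauchy_transform M z))\<^sup>2 = (expectation (\<lambda>t. Re (?r t)))\<^sup>2"
       "(Im (cauchy_transform M z))\<^sup>2 = (expectation (\<lambda>t. Im (?r t)))\<^sup>2"
    unfolding cauchy_transform_def using I by (simp_all only: integral_Re integral_Im)
  moreover have "(expectation (\<lambda>t. Re (?r t)))\<^sup>2 \<le> expectation (\<lambda>t. (Re (?r t))\<^sup>2)"
    using variance_eq[of "\<lambda>t. Re (?r t)"] variance_positive[of "\<lambda>t. Re (?r t)"] I I2
    by (simp only: integrable_Re)
  moreover have "(expectation (\<lambda>t. Im (?r t)))\<^sup>2 \<le> expectation (\<lambda>t. (Im (?r t))\<^sup>2)"
    using variance_eq[of "\<lambda>t. Im (?r t)"] variance_positive[of "\<lambda>t. Im (?r t)"] I I2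
    by (simp only: integrable_Im)
  moreover have "(LINT t|M. (norm (?r t))\<^sup>2) = expectation (\<lambda>t. (Re (?r t))\<^sup>2) + expectation (\<lambda>t. (Im (?r t))\<^sup>2)"
    unfolding cmod_power2 using I2 by (rule Bochner_Integration.integral_add)
  ultimately show ?thesis unfolding cmod_power2 by linarith
qed

lemma Im_cauchy_transform_neg:
  assumes z: "Im z > 0"
  shows "Im (cauchy_transform M z) < 0"
proof -
  let ?r = "\<lambda>t. (norm (1 / (z - complex_of_real t)))\<^sup>2"
  have "integrable M ?r"
    by (rule integrable_const_bound[where B = "(1 / Im z)\<^sup>2"])
      (use norm_resolvent_le[OF z] in \<open>auto simp del: norm_divide intro!: power_mono\<close>)
  moreover have "?r t > 0" for t using diff_of_real_nonzero[OF z, of t] by simp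
  ultimately have "(LINT t|M. ?r t) > (LINT t|M. 0)"
    by (intro integral_less_AE_space) (auto simp: emeasure_space_1[simplified])
  then show ?thesis using z by (simp add: Im_cauchy_transform)
qed

lemma cauchy_transform_nonzero: "Im z > 0 \<Longrightarrow> cauchy_transform M z \<noteq> 0"
  using Im_cauchy_transform_neg[of z] by auto

text \<open>Since \<open>Im (1 / G) = - Im G / |G|^2\<close>, it suffices that
  \<open>- Im G\<close>, which is \<open>Im z\<close> times the mean squared modulus of the
  resolvent, dominates \<open>Im z * |G|^2\<close>. Hence reciprocal transforms map the upper
  half-plane into itself and can be composed.\<close>

lemma Im_reciprocal_cauchy_transform_ge:
  assumes z: "Im z > 0"
  shows "Im z \<le> Im (reciprocal_cauchy_transform M z)"
proof -
  let ?G = "cauchy_transform M z"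
  have "Im z * (norm ?G)\<^sup>2 \<le> - Im ?G"
    using mult_left_mono[OF norm_cauchy_transform_sq_le[OF z], of "Im z"] z
    by (simp only: Im_cauchy_transform) simp
  moreover have "(norm ?G)\<^sup>2 > 0" using cauchy_transform_nonzero[OF z] by simp
  moreover have "Im (reciprocal_cauchy_transform M z) = - Im ?G / (norm ?G)\<^sup>2"
    unfolding reciprocal_cauchy_transform_def by (simp add: Im_divide cmod_power2)
  ultimately show ?thesis by (simp only: pos_le_divide_eq)
qed

text \<open>Everything follows from \<open>z / (z - t) = 1 + t / (z - t)\<close>. The bound sees
  \<open>z\<close> only through \<open>Im z\<close>, which is the decay that the existence theorem
  asks for.\<close>

lemma cauchy_transform_remainder:
  assumes z: "Im z > 0" and I: "integrable M (\<lambda>x. x)"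
  shows "integrable M (\<lambda>t. of_real t / (z - of_real t))"
    and "z * cauchy_transform M z - 1 = (LINT t|M. of_real t / (z - of_real t))"
    and "norm (z * cauchy_transform M z - 1) \<le> (LINT t|M. \<bar>t\<bar>) / Im z"
proof -
  have b: "norm (of_real t / (z - of_real t)) \<le> \<bar>t\<bar> / Im z" for t
    using mult_left_mono[OF norm_resolvent_le[OF z, of t], of "\<bar>t\<bar>"] by (simp add: norm_divide)
  have Ia: "integrable M (\<lambda>t. \<bar>t\<bar> / Im z)" using I by simp
  show Ir: "integrable M (\<lambda>t. of_real t / (z - of_real t))"
    by (rule Bochner_Integration.integrable_bound[OF Ia]) (use b z in auto)
  have "z * cauchy_transform M z = (LINT t|M. z * (1 / (z - of_real t)))"
    unfolding cauchy_transform_def by (simp only: integral_mult_right_zero)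
  also have "\<dots> = (LINT t|M. 1 + of_real t / (z - of_real t))"
    using diff_of_real_nonzero[OF z] by (intro Bochner_Integration.integral_cong) (auto simp: field_simps)
  also have "\<dots> = 1 + (LINT t|M. of_real t / (z - of_real t))"
    using Ir by (simp add: prob_space[simplified])
  finally show eq: "z * cauchy_transform M z - 1 = (LINT t|M. of_real t / (z - of_real t))" by simp
  show "norm (z * cauchy_transform M z - 1) \<le> (LINT t|M. \<bar>t\<bar>) / Im z"
    unfolding eq using order_trans[OF integral_norm_bound integral_mono[OF integrable_norm[OF Ir] Ia b]] by simp
qed

end

section \<open>Uniqueness\<close>

text \<open>Scaling this law by \<open>y\<close> gives, up to the factor \<open>1 / pi\<close>, the
  Poisson kernel of the upper half-plane at height \<open>y\<close> as density.\<close>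

definition cauchy_distribution :: "real measure" where
  "cauchy_distribution = density lborel (\<lambda>u. ennreal (1 / (pi * (1 + u\<^sup>2))))"

lemma has_bochner_integral_1_div_plus_square:
  "has_bochner_integral lborel (\<lambda>x::real. 1 / (1 + x\<^sup>2)) pi"
  using integrable_inverse_1_plus_square LBINT_inverse_1_plus_square
  by (simp add: has_bochner_integral_iff set_integrable_def interval_lebesgue_integral_def
      set_lebesgue_integral_def inverse_eq_divide)

lemma poisson_kernel_affine:
  fixes x y u :: real
  assumes "y > 0"
  shows "y / ((x + y * u - x)\<^sup>2 + y\<^sup>2) = (1 / y) * (1 / (1 + u\<^sup>2))"
proof -
  have "1 + u\<^sup>2 > 0" by (simp add: add_pos_nonneg)
  moreover have "(x + y * u - x)\<^sup>2 + y\<^sup>2 = y\<^sup>2 * (1 + u\<^sup>2)"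
    by (simp add: algebra_simps power_mult_distrib)
  ultimately show ?thesis using assms by (simp add: power2_eq_square)
qed

lemma has_bochner_integral_poisson:
  assumes y: "y > 0"
  shows "has_bochner_integral lborel (\<lambda>t. y / ((t - x)\<^sup>2 + y\<^sup>2)) pi"
proof -
  have "has_bochner_integral lborel (\<lambda>u. y / ((x + y * u - x)\<^sup>2 + y\<^sup>2)) (pi /\<^sub>R \<bar>y\<bar>)"
    unfolding poisson_kernel_affine[OF y]
    using has_bochner_integral_mult_right[OF has_bochner_integral_1_div_plus_square, of "1 / y"] y
    by (simp add: divide_inverse mult.commute)
  then show ?thesis
    using y lborel_has_bochner_integral_real_affine_iff[of y "\<lambda>t. y / ((t - x)\<^sup>2 + y\<^sup>2)" pi x] by simp
qed

lemma real_distribution_density: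
  assumes "has_bochner_integral lborel f 1" "\<And>x. f x \<ge> 0"
  shows "real_distribution (density lborel (\<lambda>x. ennreal (f x)))"
proof -
  have "f \<in> borel_measurable lborel" using assms by (auto simp: has_bochner_integral_iff)
  moreover have "(\<integral>\<^sup>+x. ennreal (f x) \<partial>lborel) = 1"
    using assms by (subst nn_integral_eq_integral) (auto simp: has_bochner_integral_iff)
  ultimately have "prob_space (density lborel (\<lambda>x. ennreal (f x)))"
    by (intro prob_spaceI) (simp add: emeasure_density)
  then show ?thesis
    by (simp add: real_distribution_def real_distribution_axioms_def)
qed

lemma real_distribution_cauchy_distribution: "real_distribution cauchy_distribution"
  unfolding cauchy_distribution_def
proof (rule real_distribution_density)
  show "has_bochner_integral lborel (\<lambda>u. 1 / (pi * (1 + u\<^sup>2))) 1"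
    using has_bochner_integral_mult_right[OF has_bochner_integral_1_div_plus_square, of "1 / pi"]
    by simp
qed (simp add: add_nonneg_nonneg)

text \<open>Stieltjes inversion: \<open>- Im G(x + iy) / \<pi>\<close> is the density of the convolution of \<open>M\<close> with the
  Cauchy distribution of scale \<open>y\<close>.\<close>
lemma (in real_distribution) char_mult_char_cauchy_distribution:
  assumes y: "y > 0"
  shows "char M s * char cauchy_distribution (y * s) =
    (LINT x|lborel. iexp (s * x) * of_real (- Im (cauchy_transform M (Complex x y)) / pi))"
proof -
  define P where "P t x = y / ((x - t)\<^sup>2 + y\<^sup>2)" for t x :: real
  have P0: "P t x \<ge> 0" for t x using y by (simp add: P_def)
  have P1: "has_bochner_integral lborel (P t) pi" for t
    unfolding P_def using has_bochner_integral_poisson[OF y] .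
  have [measurable]: "case_prod P \<in> borel_measurable (borel \<Otimes>\<^sub>M borel)"
    unfolding P_def by measurable
  interpret ps: pair_sigma_finite M lborel ..
  let ?f = "\<lambda>t x. iexp (s * x) * complex_of_real (P t x / pi)"
  have nf: "norm (?f t x) = P t x / pi" for t x
    unfolding norm_mult norm_exp_i_times norm_of_real using P0 by simp
  \<comment> \<open>Fubini applies because the exponential has modulus one and every Poisson kernel
    \<open>P t\<close> has the same total mass \<open>pi\<close>.\<close>
  have int: "integrable (M \<Otimes>\<^sub>M lborel) (case_prod ?f)"
  proof (rule ps.Fubini_integrable)
    show "case_prod ?f \<in> borel_measurable (M \<Otimes>\<^sub>M lborel)" by measurable
    have "(LINT x|lborel. P t x) = pi" for t using P1 by (simp add: has_bochner_integral_iff)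
    then show "integrable M (\<lambda>t. LINT x|lborel. norm (case_prod ?f (t, x)))"
      by (simp only: case_prod_conv nf integral_divide_zero) simp
    have "integrable lborel (?f t)" for t
    proof (rule Bochner_Integration.integrable_bound)
      show "integrable lborel (\<lambda>x. P t x / pi)" using P1 by (auto simp: has_bochner_integral_iff)
      show "?f t \<in> borel_measurable lborel" by measurable
      show "AE x in lborel. norm (?f t x) \<le> norm (P t x / pi)" unfolding nf by (simp add: divide_right_mono)
    qed
    then show "AE t in M. integrable lborel (\<lambda>x. case_prod ?f (t, x))" by simp
  qed
  have G: "- Im (cauchy_transform M (Complex x y)) = (LINT t|M. P t x)" for x
  proof -
    have "- Im (cauchy_transform M (Complex x y)) = (LINT t|M. - Im (1 / (Complex x y - of_real t)))"
      unfolding cauchy_transform_def using integrable_resolvent[of "Complex x y"] y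
      by (simp add: integral_Im)
    also have "\<dots> = (LINT t|M. P t x)"
      by (simp add: P_def Im_divide power2_eq_square)
    finally show ?thesis .
  qed
  \<comment> \<open>The substitution \<open>x = t + y * u\<close> splits the exponential into a
    factor in \<open>t\<close> and one that integrates to the characteristic function of the
    standard Cauchy law at \<open>y * s\<close>.\<close>
  have inner: "(LINT x|lborel. ?f t x) = iexp (s * t) * char cauchy_distribution (y * s)" for t
  proof -
    have Pa: "P t (t + y * u) = 1 / (1 + u\<^sup>2) / y" for u
      using poisson_kernel_affine[OF y, of t u] by (simp add: P_def)
    have "(LINT x|lborel. ?f t x) = y *\<^sub>R (LINT u|lborel. ?f t (t + y * u))"
      using y by (subst lborel_integral_real_affine[where c = y and t = t]) auto
    also have "\<dots> = (LINT u|lborel. y *\<^sub>R ?f t (t + y * u))"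
      by (simp only: integral_scaleR_right)
    also have "\<dots> = (LINT u|lborel. iexp (s * t) * ((1 / (pi * (1 + u\<^sup>2))) *\<^sub>R iexp (y * s * u)))"
    proof (rule Bochner_Integration.integral_cong[OF refl])
      fix u
      have "y * (P t (t + y * u) / pi) = 1 / (pi * (1 + u\<^sup>2))"
        using y by (simp add: Pa)
      moreover have "iexp (s * (t + y * u)) = iexp (s * t) * iexp (y * s * u)"
        by (simp add: exp_add[symmetric] algebra_simps)
      moreover have "y *\<^sub>R ?f t (t + y * u) = iexp (s * (t + y * u)) * of_real (y * (P t (t + y * u) / pi))"
        by (simp add: scaleR_conv_of_real)
      ultimately show "y *\<^sub>R ?f t (t + y * u) = iexp (s * t) * ((1 / (pi * (1 + u\<^sup>2))) *\<^sub>R iexp (y * s * u))"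
        by (simp only: scaleR_conv_of_real mult_ac)
    qed
    also have "\<dots> = iexp (s * t) * (LINT u|lborel. (1 / (pi * (1 + u\<^sup>2))) *\<^sub>R iexp (y * s * u))"
      by (rule integral_mult_right_zero)
    also have "\<dots> = iexp (s * t) * char cauchy_distribution (y * s)"
      unfolding char_def cauchy_distribution_def
      by (subst integral_density) (auto simp: add_nonneg_nonneg)
    finally show ?thesis .
  qed
  have "(LINT x|lborel. iexp (s * x) * of_real (- Im (cauchy_transform M (Complex x y)) / pi))
     = (LINT x|lborel. LINT t|M. ?f t x)"
    unfolding G by (simp add: integral_complex_of_real[symmetric] del: integral_complex_of_real)
  also have "\<dots> = (LINT t|M. LINT x|lborel. ?f t x)" by (rule ps.Fubini_integral[OF int])
  also have "\<dots> = char M s * char cauchy_distribution (y * s)"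
    unfolding inner char_def by simp
  finally show ?thesis by simp
qed

text \<open>By inversion both characteristic functions at \<open>s\<close>, times the same Cauchy
  factor, agree. That factor tends to 1 as \<open>y\<close> tends to 0, so some \<open>y > 0\<close>
  makes it nonzero and it cancels.\<close>

lemma cauchy_transform_unique:
  assumes M: "real_distribution M" "real_distribution N"
    and eq: "\<And>z. Im z > 0 \<Longrightarrow> cauchy_transform M z = cauchy_transform N z"
  shows "M = N"
proof (rule Levy_uniqueness[OF M], rule ext)
  fix s
  interpret M: real_distribution M by fact
  interpret N: real_distribution N by fact
  interpret C: real_distribution cauchy_distribution by (rule real_distribution_cauchy_distribution)
  have "((\<lambda>y. char cauchy_distribution (y * s)) \<longlongrightarrow> char cauchy_distribution 0) (at_right 0)"
    by (rule isCont_tendsto_compose[OF C.isCont_char]) (auto intro!: tendsto_eq_intros)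
  then have "\<forall>\<^sub>F y in at_right 0. char cauchy_distribution (y * s) \<noteq> 0"
    by (rule tendsto_imp_eventually_ne) (simp add: C.char_zero)
  moreover have "\<forall>\<^sub>F y in at_right (0::real). y > 0"
    by (simp add: eventually_at_filter)
  ultimately have "\<forall>\<^sub>F y in at_right 0. char cauchy_distribution (y * s) \<noteq> 0 \<and> y > 0"
    by eventually_elim simp
  then obtain y where y: "char cauchy_distribution (y * s) \<noteq> 0" "y > 0"
    using eventually_happens'[of "at_right (0::real)"] by auto
  have "char M s * char cauchy_distribution (y * s) = char N s * char cauchy_distribution (y * s)"
    unfolding M.char_mult_char_cauchy_distribution[OF y(2)] N.char_mult_char_cauchy_distribution[OF y(2)]
    using eq y(2) by simp
  then show "char M s = char N s" using y by simp
qed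

section \<open>Existence\<close>

text \<open>The segment from \<open>-n\<close> to \<open>n\<close> is closed by the upper
  semicircle: Cauchy's theorem gives 0 for the closed contour, and the arc contributes at most
  \<open>C * pi / n\<close>. The margin \<open>d\<close> lets the contour run along the real axis
  itself.\<close>

lemma has_bochner_integral_real_axis_eq_0:
  fixes h :: "complex \<Rightarrow> complex"
  assumes hol: "h holomorphic_on {w. Im w > - d}" and d: "d > 0" and r: "r > 0"
    and decay: "\<And>w. Im w \<ge> 0 \<Longrightarrow> norm w \<ge> r \<Longrightarrow> norm (h w) \<le> C / (norm w)\<^sup>2"
  shows "has_bochner_integral lborel (\<lambda>t. h (of_real t)) 0"
proof -
  have conth: "continuous_on {w. Im w > - d} h" by (rule holomorphic_on_imp_continuous_on[OF hol])
  have cont: "continuous_on UNIV (\<lambda>t. h (complex_of_real t))"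
    by (rule continuous_on_compose2[OF conth]) (use d in \<open>auto intro!: continuous_intros\<close>)
  have meas: "(\<lambda>t. h (complex_of_real t)) \<in> borel_measurable lborel"
    using borel_measurable_continuous_onI[OF cont] by simp
  have "compact ((\<lambda>t. h (complex_of_real t)) ` {-r..r})"
    by (rule compact_continuous_image[OF continuous_on_subset[OF cont]]) auto
  from compact_imp_bounded[OF this] obtain B where "\<forall>t\<in>{-r..r}. norm (h (of_real t)) \<le> B"
    unfolding bounded_iff by auto
  then have B: "\<bar>t\<bar> \<le> r \<Longrightarrow> norm (h (of_real t)) \<le> B" for t by (auto simp: abs_le_iff)
  have "B \<ge> 0" using order_trans[OF norm_ge_zero B[of 0]] r by simp
  have "0 \<le> C / r\<^sup>2"
    using order_trans[OF norm_ge_zero decay[of "of_real r"]] r by simp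
  then have "C \<ge> 0" using r by (simp add: zero_le_divide_iff)
  \<comment> \<open>\<open>K\<close> is to bound \<open>norm (h t) * (1 + t^2)\<close>: the first
    summand serves \<open>\<bar>t\<bar> \<le> r\<close>, the second the region where the decay
    hypothesis applies.\<close>
  define K where "K = B * (1 + r\<^sup>2) + C * (1 + 1 / r\<^sup>2)"
  have bnd: "norm (h (of_real t)) \<le> K * (1 / (1 + t\<^sup>2))" for t :: real
  proof -
    have pos: "1 + t\<^sup>2 > 0" by (simp add: add_pos_nonneg)
    have "norm (h (of_real t)) * (1 + t\<^sup>2) \<le> K"
    proof (cases "\<bar>t\<bar> \<le> r")
      case True
      have "t\<^sup>2 \<le> r\<^sup>2" using True r by (simp add: power2_le_iff_abs_le)
      then have "norm (h (of_real t)) * (1 + t\<^sup>2) \<le> B * (1 + r\<^sup>2)"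
        using B[OF True] \<open>B \<ge> 0\<close> by (intro mult_mono) auto
      then show ?thesis using \<open>C \<ge> 0\<close> by (simp add: K_def add_increasing2)
    next
      case False
      then have t: "r\<^sup>2 \<le> t\<^sup>2" "t \<noteq> 0" using r by (auto simp: abs_le_square_iff[symmetric])
      have "norm (h (of_real t)) * (1 + t\<^sup>2) \<le> C / t\<^sup>2 * (1 + t\<^sup>2)"
        using decay[of "of_real t"] False pos by (intro mult_right_mono) auto
      also have "\<dots> = C * (1 + 1 / t\<^sup>2)" using t by (simp add: field_simps)
      also have "\<dots> \<le> C * (1 + 1 / r\<^sup>2)"
        using t r \<open>C \<ge> 0\<close> by (intro mult_left_mono add_left_mono divide_left_mono) auto
      also have "\<dots> \<le> K" using \<open>B \<ge> 0\<close> by (simp add: K_def)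
      finally show ?thesis .
    qed
    then show ?thesis using pos by (simp add: pos_le_divide_eq)
  qed
  have intK: "integrable lborel (\<lambda>t. K * (1 / (1 + t\<^sup>2)))"
    using has_bochner_integral_mult_right[OF has_bochner_integral_1_div_plus_square]
    by (auto simp: has_bochner_integral_iff simp del: times_divide_eq_right)
  have int: "integrable lborel (\<lambda>t. h (complex_of_real t))"
    by (rule Bochner_Integration.integrable_bound[OF intK meas])
       (use bnd in \<open>auto intro: order_trans[OF _ abs_ge_self] simp del: times_divide_eq_right\<close>)
  let ?I = "\<lambda>n. LINT t|lborel. indicator {-real n..real n} t *\<^sub>R h (complex_of_real t)"
  have lim: "?I \<longlonglongrightarrow> (LINT t|lborel. h (complex_of_real t))"
  proof (rule integral_dominated_convergence[where w = "\<lambda>t. norm (h (complex_of_real t))"])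
    show "AE t in lborel. (\<lambda>n. indicator {-real n..real n} t *\<^sub>R h (complex_of_real t))
        \<longlonglongrightarrow> h (complex_of_real t)"
    proof (rule AE_I2)
      fix t :: real
      obtain N where N: "\<bar>t\<bar> \<le> real N" using real_arch_simple by blast
      have "\<forall>\<^sub>F n in sequentially. indicator {-real n..real n} t *\<^sub>R h (complex_of_real t) = h (complex_of_real t)"
        using eventually_ge_at_top[of N] by eventually_elim (use N in \<open>auto simp: indicator_def\<close>)
      then show "(\<lambda>n. indicator {-real n..real n} t *\<^sub>R h (complex_of_real t)) \<longlonglongrightarrow> h (complex_of_real t)"
        by (rule tendsto_eventually)
    qed
  qed (use int meas in \<open>auto simp: indicator_def\<close>)
  have bI: "norm (?I n) \<le> C * pi / real n" if n: "real n \<ge> r" for n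
  proof -
    have n0: "real n > 0" using n r by simp
    let ?a = "part_circlepath 0 (real n) 0 pi" and ?l = "linepath (complex_of_real (- real n)) (of_real (real n))"
    have ima: "path_image ?a \<subseteq> {w. Im w \<ge> 0 \<and> norm w = real n}"
      using n0 by (subst path_image_part_circlepath)
        (auto simp: norm_mult sin_ge_zero Im_exp intro!: mult_nonneg_nonneg)
    have iml: "path_image ?l \<subseteq> {w. Im w \<ge> 0}"
      by (auto simp: closed_segment_def)
    have sub: "{w. Im w \<ge> 0} \<subseteq> {w. Im w > - d}" using d by auto
    have "(h has_contour_integral 0) (?a +++ ?l)"
    proof (rule Cauchy_theorem_convex_simple[OF hol])
      show "convex {w. Im w > - d}" by (rule convex_halfspace_Im_gt)
      show "path_image (?a +++ ?l) \<subseteq> {w. Im w > - d}"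
        using ima iml sub by (subst path_image_join) (auto simp: exp_pi_i)
    qed (auto simp: exp_pi_i intro!: valid_path_join)
    moreover have ca: "h contour_integrable_on ?a"
      by (rule contour_integrable_continuous_part_circlepath[OF continuous_on_subset[OF conth]])
         (use ima d in fastforce)
    moreover have cl: "h contour_integrable_on ?l"
      by (rule contour_integrable_continuous_linepath[OF continuous_on_subset[OF conth]])
         (use iml d in fastforce)
    ultimately have "contour_integral ?a h + contour_integral ?l h = 0"
      using contour_integral_join[OF ca cl] contour_integral_unique by (simp add: exp_pi_i)
    then have "norm (contour_integral ?l h) = norm (contour_integral ?a h)"
      by (metis add_eq_0_iff norm_minus_cancel)
    also have "\<dots> \<le> (C / (real n)\<^sup>2) * real n * \<bar>pi - 0\<bar>"
      by (rule contour_integral_bound_part_circlepath[OF ca])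
         (use ima n n0 \<open>C \<ge> 0\<close> decay in \<open>auto, fastforce\<close>)
    also have "\<dots> = C * pi / real n" using n0 by (simp add: power2_eq_square)
    also have "contour_integral ?l h = integral {-real n..real n} (\<lambda>t. h (of_real t))"
      using n0 by (subst contour_integral_linepath_Reals_eq) auto
    also have "\<dots> = ?I n"
      using integrable_mult_indicator[OF _ int, of "{-real n..real n}"]
      by (subst set_borel_integral_eq_integral(2)[symmetric])
         (auto simp: set_integrable_def set_lebesgue_integral_def)
    finally show ?thesis .
  qed
  have "?I \<longlonglongrightarrow> 0"
  proof (rule Lim_null_comparison)
    obtain N where "r \<le> real N" using real_arch_simple by blast
    then show "\<forall>\<^sub>F n in sequentially. norm (?I n) \<le> C * pi / real n"
      using bI by (intro eventually_sequentiallyI[of N]) auto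
    show "(\<lambda>n. C * pi / real n) \<longlonglongrightarrow> 0" by (rule lim_const_over_n)
  qed
  then have "(LINT t|lborel. h (complex_of_real t)) = 0" by (rule LIMSEQ_unique[OF lim])
  then show ?thesis using int by (simp add: has_bochner_integral_iff)
qed

text \<open>Cauchy's formula at \<open>p\<close> and, reflected, at \<open>cnj p\<close> (where the integral vanishes) combine to
  eliminate the real part of \<open>H\<close>.\<close>
lemma has_bochner_integral_Im_Cauchy:
  fixes H :: "complex \<Rightarrow> complex"
  assumes hol: "H holomorphic_on {w. Im w > - d}" and d: "d > 0"
    and decay: "\<And>w. Im w \<ge> 0 \<Longrightarrow> norm (w * H w) \<le> C" and p: "Im p > 0"
  shows "has_bochner_integral lborel
    (\<lambda>t. (- Im (H (of_real t)) / pi) *\<^sub>R (1 / (p - of_real t))) (H p)"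
proof -
  \<comment> \<open>The half-plane is cut at height \<open>- e\<close> so that \<open>cnj p\<close>,
    at height \<open>- Im p\<close>, lies outside it.\<close>
  define e where "e = min d (Im p)"
  have e: "e > 0" using d p by (simp add: e_def)
  define S where "S = {w. Im w > - e}"
  have S: "open S" unfolding S_def by (rule open_halfspace_Im_gt)
  have holS: "H holomorphic_on S"
    by (rule holomorphic_on_subset[OF hol]) (auto simp: S_def e_def)
  have nz: "w - cnj p \<noteq> 0" if "w \<in> S" for w
  proof
    assume "w - cnj p = 0"
    then have "Im w = - Im p" by (simp add: complex_eq_iff)
    then show False using that by (simp add: S_def e_def)
  qed
  \<comment> \<open>Beyond this radius \<open>w\<close> keeps distance at least
    \<open>norm w / 2\<close> from both \<open>p\<close> and \<open>cnj p\<close>, so dividing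
    \<open>H\<close> by either difference gives quadratic decay.\<close>
  define r where "r = 2 * norm p"
  have r: "r > 0" using p by (auto simp: r_def)
  have far: "norm w / 2 \<le> norm (w - p)" "norm w / 2 \<le> norm (w - cnj p)" if "norm w \<ge> r" for w
    using norm_triangle_ineq2[of w p] norm_triangle_ineq2[of w "cnj p"] that unfolding r_def complex_mod_cnj by linarith+
  have C: "norm (H w) \<le> C / norm w" if "Im w \<ge> 0" "norm w \<ge> r" for w
    using decay[OF that(1)] less_le_trans[OF r that(2)]
    by (simp add: norm_mult pos_le_divide_eq mult.commute)
  have fracle: "norm (H w / q) \<le> 2 * C / (norm w)\<^sup>2" if w: "Im w \<ge> 0" "norm w \<ge> r" and q: "norm w / 2 \<le> norm q" for w q
  proof -
    have "norm w > 0" using w r by linarith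
    then have "norm (H w / q) \<le> (C / norm w) / (norm w / 2)"
      unfolding norm_divide using C[OF w] q by (intro frac_le) (auto intro: order_trans[OF norm_ge_zero])
    then show ?thesis by (simp add: power2_eq_square mult.commute)
  qed
  have I2: "has_bochner_integral lborel (\<lambda>t. H (of_real t) / (of_real t - cnj p)) 0"
  proof (rule has_bochner_integral_real_axis_eq_0[where h = "\<lambda>w. H w / (w - cnj p)", OF _ e r])
    show "(\<lambda>w. H w / (w - cnj p)) holomorphic_on {w. - e < Im w}"
      using holS nz unfolding S_def by (intro holomorphic_intros) auto
    show "norm (H w / (w - cnj p)) \<le> 2 * C / (norm w)\<^sup>2" if "Im w \<ge> 0" "norm w \<ge> r" for w
      using fracle[OF that far(2)[OF that(2)]] .
  qed
  \<comment> \<open>\<open>k\<close> is \<open>H w / (w - p)\<close> with its pole removed. The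
    factor \<open>w - cnj p\<close> makes the subtracted term decay quadratically, and on the real
    axis that term is a constant multiple of the Poisson kernel.\<close>
  define f where "f w = H w * (w - cnj p)" for w
  define k where "k w = (if w = p then deriv f p else (f w - f p) / (w - p)) / (w - cnj p)" for w
  have fh: "f holomorphic_on S" unfolding f_def using holS by (intro holomorphic_intros)
  have kw: "k w = H w / (w - p) - f p / ((w - p) * (w - cnj p))" if "w \<noteq> p" "w - cnj p \<noteq> 0" for w
    using that by (simp add: k_def f_def diff_divide_distrib)
  have I1: "has_bochner_integral lborel (\<lambda>t. k (of_real t)) 0"
  proof (rule has_bochner_integral_real_axis_eq_0[OF _ e r])
    show "k holomorphic_on {w. - e < Im w}"
      using pole_lemma_open[OF fh S, of p] nz unfolding k_def S_def
      by (intro holomorphic_on_divide holomorphic_intros) auto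
    show "norm (k w) \<le> (2 * C + 4 * norm (f p)) / (norm w)\<^sup>2" if w: "Im w \<ge> 0" "norm w \<ge> r" for w
    proof -
      have "norm w > 0" using w r by linarith
      have "w \<noteq> p" using far(1)[OF w(2)] \<open>norm w > 0\<close> by auto
      moreover have "w - cnj p \<noteq> 0" using far(2)[OF w(2)] \<open>norm w > 0\<close> by auto
      ultimately have "norm (k w) \<le> norm (H w / (w - p)) + norm (f p / ((w - p) * (w - cnj p)))"
        using kw norm_triangle_ineq4 by metis
      also have "norm (f p / ((w - p) * (w - cnj p))) \<le> norm (f p) / ((norm w / 2) * (norm w / 2))"
        unfolding norm_divide norm_mult using far[OF w(2)] \<open>norm w > 0\<close>
        by (intro frac_le mult_mono mult_pos_pos) auto
      also have "norm (H w / (w - p)) \<le> 2 * C / (norm w)\<^sup>2"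
        using fracle[OF w far(1)[OF w(2)]] .
      finally show ?thesis by (simp add: power2_eq_square add_divide_distrib mult.commute)
    qed
  qed
  have tp: "complex_of_real t \<noteq> p" "complex_of_real t - cnj p \<noteq> 0" for t
    using p by (auto simp: complex_eq_iff)
  have "f p = H p * (2 * \<i> * of_real (Im p))"
    by (simp add: f_def complex_eq_iff)
  moreover have "(complex_of_real t - p) * (of_real t - cnj p) = of_real ((t - Re p)\<^sup>2 + (Im p)\<^sup>2)" for t
    by (simp add: complex_eq_iff power2_eq_square algebra_simps)
  ultimately have "f p / ((complex_of_real t - p) * (of_real t - cnj p))
      = (H p * (2 * \<i>)) * of_real (Im p / ((t - Re p)\<^sup>2 + (Im p)\<^sup>2))" for t
    by simp
  then have "has_bochner_integral lborel (\<lambda>t. f p / ((complex_of_real t - p) * (of_real t - cnj p)))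
      ((H p * (2 * \<i>)) * of_real pi)"
    using has_bochner_integral_mult_right[OF has_bochner_integral_of_real[OF has_bochner_integral_poisson[OF p, of "Re p"]],
        where c = "H p * (2 * \<i>)"] by (simp only:)
  from has_bochner_integral_add[OF I1 this]
  have I1': "has_bochner_integral lborel (\<lambda>t. H (of_real t) / (of_real t - p)) ((H p * (2 * \<i>)) * of_real pi)"
    using tp by (simp add: kw)
  \<comment> \<open>For real \<open>t\<close> conjugation turns \<open>t - cnj p\<close> into
    \<open>t - p\<close>, so \<open>H\<close> and \<open>cnj H\<close> stand over the same
    denominator and their difference leaves only \<open>Im H\<close>.\<close>
  have I2': "has_bochner_integral lborel (\<lambda>t. cnj (H (of_real t)) / (of_real t - p)) 0"
    using has_bochner_integral_bounded_linear[OF bounded_linear_cnj I2] by simp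
  have "has_bochner_integral lborel (\<lambda>t. (1 / (2 * \<i> * of_real pi)) *
     (H (of_real t) / (of_real t - p) - cnj (H (of_real t)) / (of_real t - p)))
     ((1 / (2 * \<i> * of_real pi)) * ((H p * (2 * \<i>)) * of_real pi - 0))"
    by (intro has_bochner_integral_mult_right has_bochner_integral_diff I1' I2')
  moreover have "(1 / (2 * \<i> * of_real pi)) * ((H p * (2 * \<i>)) * of_real pi - 0) = H p"
    by (simp add: complex_eq_iff)
  moreover have "(1 / (2 * \<i> * of_real pi)) *
     (H (of_real t) / (of_real t - p) - cnj (H (of_real t)) / (of_real t - p))
     = (- Im (H (of_real t)) / pi) *\<^sub>R (1 / (p - of_real t))" for t
  proof -
    have "H (of_real t) - cnj (H (of_real t)) = 2 * \<i> * of_real (Im (H (of_real t)))"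
      by (simp add: complex_eq_iff)
    then have "(1 / (2 * \<i> * of_real pi)) *
     (H (of_real t) / (of_real t - p) - cnj (H (of_real t)) / (of_real t - p)) =
       of_real (Im (H (of_real t))) / (of_real pi * (of_real t - p))"
      by (simp flip: diff_divide_distrib)
    moreover have "of_real t - p \<noteq> 0" using tp(1)[of t] by simp
    ultimately show ?thesis
      by (simp add: scaleR_conv_of_real) (simp add: field_simps)
  qed
  ultimately show ?thesis by (simp only:)
qed

section \<open>Imaginary-axis estimates and approximation by shifted transforms\<close>

lemma fraction_of_sum_eq:
  fixes a b :: real
  assumes "a + b > 0"
  shows "b / (a + b) = 1 - a / (a + b)"
  using assms by (simp add: field_simps)

text \<open>The resulting kernel increases to 1 with \<open>y\<close>, which opens real parts on the
  imaginary axis to monotone convergence.\<close>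

lemma Re_resolvent_imaginary:
  fixes y t :: real
  assumes "y > 0"
  shows "Re (\<i> * y * (1 / (\<i> * y - t))) = y\<^sup>2 / (t\<^sup>2 + y\<^sup>2)"
proof -
  have "Re (\<i> * y * (1 / (\<i> * y - t))) = - y * Im (1 / (\<i> * y - t))"
    by (simp only: times_complex.sel Re_complex_of_real Im_complex_of_real imaginary_unit.sel
        mult_zero_left mult_zero_right mult_1 diff_0 diff_zero add_0 add_0_right mult_minus_left)
  also have "Im (1 / (\<i> * y - t)) = - y / (t\<^sup>2 + y\<^sup>2)"
    by (simp add: Im_divide)
  finally show ?thesis by (simp add: power2_eq_square)
qed

text \<open>At \<open>z = \<i> * y\<close> the real part of \<open>1 - z / (z - t)\<close> is
  \<open>t^2 / (t^2 + y^2)\<close>, at least one half once \<open>\<bar>t\<bar> \<ge> y\<close>.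
  Tightness can thus be read off the transforms.\<close>

lemma (in real_distribution) prob_abs_ge_le_cauchy_transform:
  assumes y: "y > 0"
  shows "prob {t. y \<le> \<bar>t\<bar>} \<le> 2 * norm (\<i> * y * cauchy_transform M (\<i> * y) - 1)"
proof -
  let ?z = "\<i> * complex_of_real y"
  have z: "Im ?z > 0" using y by simp
  have Iz: "integrable M (\<lambda>t. ?z * (1 / (?z - of_real t)))"
    by (rule integrable_mult_right) (rule integrable_resolvent[OF z])
  then have I: "integrable M (\<lambda>t. 1 - ?z * (1 / (?z - of_real t)))"
    by (intro Bochner_Integration.integrable_diff integrable_const)
  have Re: "Re (1 - ?z * (1 / (?z - of_real t))) = t\<^sup>2 / (t\<^sup>2 + y\<^sup>2)" for t
  proof -
    have "t\<^sup>2 + y\<^sup>2 > 0" using y by (simp add: add_nonneg_pos)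
    then show ?thesis
      unfolding minus_complex.sel Re_resolvent_imaginary[OF y] one_complex.sel
      by (simp only: fraction_of_sum_eq diff_diff_eq2)
  qed
  have "indicator {t. y \<le> \<bar>t\<bar>} t \<le> 2 * Re (1 - ?z * (1 / (?z - of_real t)))" for t
  proof -
    have "t\<^sup>2 + y\<^sup>2 > 0" using y by (simp add: add_nonneg_pos)
    moreover have "y\<^sup>2 \<le> t\<^sup>2" if "y \<le> \<bar>t\<bar>" using that y by (simp add: abs_le_square_iff[symmetric])
    ultimately show ?thesis unfolding Re by (auto simp: indicator_def pos_le_divide_eq)
  qed
  moreover have "integrable M (indicator {t. y \<le> \<bar>t\<bar>} :: real \<Rightarrow> real)"
    by (intro integrable_real_indicator) (auto simp: less_top[symmetric])
  ultimately have "(LINT t|M. indicator {t. y \<le> \<bar>t\<bar>} t) \<le> (LINT t|M. 2 * Re (1 - ?z * (1 / (?z - of_real t))))"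
    by (intro integral_mono integrable_mult_right integrable_Re I)
  then have "prob {t. y \<le> \<bar>t\<bar>} \<le> (LINT t|M. 2 * Re (1 - ?z * (1 / (?z - of_real t))))"
    by simp
  also have "\<dots> = 2 * Re (LINT t|M. 1 - ?z * (1 / (?z - of_real t)))"
    using I by (simp only: integral_mult_right_zero integral_Re)
  also have "(LINT t|M. 1 - ?z * (1 / (?z - of_real t))) = 1 - ?z * cauchy_transform M ?z"
    unfolding cauchy_transform_def
    using Iz by (simp only: Bochner_Integration.integral_diff integrable_const integral_mult_right_zero)
       (simp add: prob_space[simplified])
  also have "2 * Re (1 - ?z * cauchy_transform M ?z) \<le> 2 * norm (1 - ?z * cauchy_transform M ?z)"
    by (intro mult_left_mono complex_Re_le_cmod) simp
  finally show ?thesis by (simp add: norm_minus_commute)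
qed

text \<open>With \<open>z' = z + \<i> * e\<close>, write \<open>z * g - 1\<close> as
  \<open>z / z' * (z' * g - 1) - \<i> * e / z'\<close> and use \<open>norm z \<le> norm z'\<close>.
  Taking \<open>g = G z'\<close> transfers the decay of \<open>G\<close> to its shift.\<close>

lemma norm_shift_estimate:
  fixes z g :: complex
  assumes z: "Im z > 0" and e: "e > 0"
    and le: "norm ((z + \<i> * of_real e) * g - 1) \<le> C / Im (z + \<i> * of_real e)"
  shows "norm (z * g - 1) \<le> (C + e) / Im z"
proof -
  define z' where "z' = z + \<i> * of_real e"
  have Im': "Im z' = Im z + e" by (simp add: z'_def)
  have z': "z' \<noteq> 0" using Im' z e by auto
  have zz': "norm z \<le> norm z'"
    unfolding z'_def cmod_def using z e by (auto intro!: power_mono)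
  have "0 \<le> C / Im z'" using order_trans[OF norm_ge_zero le] unfolding z'_def .
  then have C: "0 \<le> C" using Im' z e by (simp add: zero_le_divide_iff)
  have "z * g - 1 = z / z' * (z' * g - 1) - \<i> * of_real e / z'"
    using z' by (simp add: divide_simps) (simp add: z'_def algebra_simps)
  also have "norm \<dots> \<le> norm (z / z') * norm (z' * g - 1) + e / norm z'"
    using e by (intro order_trans[OF norm_triangle_ineq4]) (simp add: norm_mult norm_divide)
  also have "\<dots> \<le> 1 * (C / Im z) + e / Im z"
  proof (intro add_mono mult_mono divide_left_mono)
    have "norm (z' * g - 1) \<le> C / Im z'" using le by (simp add: z'_def)
    also have "\<dots> \<le> C / Im z" using C z e Im' by (intro divide_left_mono) auto
    finally show "norm (z' * g - 1) \<le> C / Im z" .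
    show "norm (z / z') \<le> 1" using zz' z' by (simp add: norm_divide)
    show "Im z \<le> norm z'" using abs_Im_le_cmod[of z'] Im' z e by simp
    show "0 < norm z' * Im z" using z' z by simp
  qed (use e z in auto)
  finally show "norm (z * g - 1) \<le> (C + e) / Im z" by (simp add: add_divide_distrib)
qed

text \<open>The shift is holomorphic across the real axis, so
  \<open>has_bochner_integral_Im_Cauchy\<close> exhibits it as the transform of a density. The sign
  condition makes the density nonnegative, the decay gives it mass one.\<close>

lemma cauchy_transform_shift_representation:
  assumes hol: "G holomorphic_on {z. Im z > 0}"
    and neg: "\<And>z. Im z > 0 \<Longrightarrow> Im (G z) \<le> 0" and e: "e > 0"
    and asy: "\<And>z. Im z \<ge> e \<Longrightarrow> norm (z * G z - 1) \<le> C / Im z"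
  shows "\<exists>\<rho>. real_distribution \<rho> \<and>
    (\<forall>z. Im z > 0 \<longrightarrow> cauchy_transform \<rho> z = G (z + \<i> * of_real e))"
proof -
  define H where "H w = G (w + \<i> * of_real e)" for w
  define g where "g t = - Im (H (of_real t)) / pi" for t :: real
  have holH: "H holomorphic_on {w. Im w > - e}"
    unfolding H_def by (rule holomorphic_on_compose_gen[OF _ hol, unfolded o_def])
      (auto intro!: holomorphic_intros)
  have cont: "continuous_on UNIV (\<lambda>t. H (complex_of_real t))"
    by (rule continuous_on_compose2[OF holomorphic_on_imp_continuous_on[OF holH]])
       (use e in \<open>auto intro!: continuous_intros\<close>)
  have [measurable]: "g \<in> borel_measurable borel"
    unfolding g_def by (intro borel_measurable_continuous_onI continuous_intros cont) simp
  have g0: "g t \<ge> 0" for t using neg[of "of_real t + \<i> * of_real e"] e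
    by (simp add: g_def H_def divide_nonpos_pos)
  have "0 \<le> C / e" using order_trans[OF norm_ge_zero asy[of "\<i> * of_real e"]] by simp
  then have C: "C \<ge> 0" using e by (simp add: zero_le_divide_iff)
  have bnd: "norm (w * H w) \<le> 1 + C / e" if "Im w \<ge> 0" for w
  proof -
    let ?w = "w + \<i> * of_real e"
    have "norm w \<le> norm ?w"
      unfolding cmod_def using that e by (auto intro!: power_mono)
    then have "norm (w * H w) \<le> norm (?w * H w)"
      by (simp add: norm_mult mult_right_mono)
    also have "\<dots> \<le> norm (?w * H w - 1) + 1"
      using norm_triangle_ineq[of "?w * H w - 1" 1] by simp
    also have "norm (?w * H w - 1) \<le> C / Im ?w"
      unfolding H_def using asy[of ?w] that by simp
    also have "\<dots> \<le> C / e" using C e that by (intro divide_left_mono) auto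
    finally show ?thesis by simp
  qed
  have bi: "has_bochner_integral lborel (\<lambda>t. g t *\<^sub>R (1 / (p - of_real t))) (H p)" if "Im p > 0" for p
    unfolding g_def using has_bochner_integral_Im_Cauchy[OF holH e bnd that] .
  \<comment> \<open>Integrability of \<open>g\<close> is still open here. At
    \<open>p = \<i> * (n + 1)\<close> the real part of \<open>p * H p\<close> is the integral of
    \<open>g\<close> against kernels increasing to 1, while \<open>p * H p\<close> tends to 1;
    monotone convergence yields integrability and mass together.\<close>
  have mass: "has_bochner_integral lborel g 1"
  proof -
    let ?p = "\<lambda>n. \<i> * complex_of_real (real (Suc n))"
    let ?q = "\<lambda>n t. (real (Suc n))\<^sup>2 / (t\<^sup>2 + (real (Suc n))\<^sup>2)"
    have bq: "has_bochner_integral lborel (\<lambda>t. g t * ?q n t) (Re (?p n * H (?p n)))" for n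
    proof -
      have "Re (?p n * (g t *\<^sub>R (1 / (?p n - of_real t)))) = g t * ?q n t" for t
      proof -
        have "Re (?p n * (1 / (?p n - of_real t))) = ?q n t"
          using Re_resolvent_imaginary[of "real (Suc n)" t] by (simp only: of_nat_0_less_iff zero_less_Suc)
        moreover have "?p n * (g t *\<^sub>R (1 / (?p n - of_real t))) = g t *\<^sub>R (?p n * (1 / (?p n - of_real t)))"
          by (rule mult_scaleR_right)
        ultimately show ?thesis by (simp only: scaleR_complex.sel)
      qed
      then show ?thesis
        using has_bochner_integral_bounded_linear[OF bounded_linear_Re
          has_bochner_integral_mult_right[OF bi, where c = "?p n"], of "?p n"]
        by simp
    qed
    have m1: "integrable lborel (\<lambda>t. g t * ?q n t)" for n
      using bq by (auto simp only: has_bochner_integral_iff)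
    have q: "?q n t = 1 - t\<^sup>2 / (t\<^sup>2 + (real (Suc n))\<^sup>2)" for n t
    proof -
      have "t\<^sup>2 + (real (Suc n))\<^sup>2 > 0" by (simp add: add_nonneg_pos)
      then show ?thesis by (rule fraction_of_sum_eq)
    qed
    have "mono (\<lambda>n. ?q n t)" for t
      unfolding mono_def q
    proof (intro allI impI diff_left_mono divide_left_mono add_left_mono power_mono mult_pos_pos)
    qed (auto simp: add_nonneg_pos)
    then have m2: "AE t in lborel. mono (\<lambda>n. g t * ?q n t)"
      using g0 unfolding mono_def by (intro AE_I2) (meson mult_left_mono)
    have "(\<lambda>n. ?q n t) \<longlonglongrightarrow> 1" for t
    proof -
      have "(\<lambda>n. 1 - t\<^sup>2 / (t\<^sup>2 + (real (Suc n))\<^sup>2)) \<longlonglongrightarrow> 1" by real_asymp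
      then show ?thesis unfolding q .
    qed
    then have m3': "(\<lambda>n. g t * ?q n t) \<longlonglongrightarrow> g t" for t
      using tendsto_mult[OF tendsto_const[of "g t"]] by fastforce
    have m3: "AE t in lborel. (\<lambda>n. g t * ?q n t) \<longlonglongrightarrow> g t"
      by (intro AE_I2 m3')
    have "(\<lambda>n. ?p n * H (?p n) - 1) \<longlonglongrightarrow> 0"
    proof (rule Lim_null_comparison)
      show "\<forall>\<^sub>F n in sequentially. norm (?p n * H (?p n) - 1) \<le> (C + e) / real (Suc n)"
      proof (rule always_eventually, rule allI)
        fix n show "norm (?p n * H (?p n) - 1) \<le> (C + e) / real (Suc n)"
          using norm_shift_estimate[OF _ e asy, of "?p n"] by (simp add: H_def)
      qed
      show "(\<lambda>n. (C + e) / real (Suc n)) \<longlonglongrightarrow> 0"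
        using LIMSEQ_Suc[OF lim_const_over_n] .
    qed
    then have "(\<lambda>n. ?p n * H (?p n)) \<longlonglongrightarrow> 1" by (simp only: LIM_zero_iff)
    then have "(\<lambda>n. Re (?p n * H (?p n))) \<longlonglongrightarrow> Re 1" by (rule tendsto_Re)
    then have m4: "(\<lambda>n. LINT t|lborel. g t * ?q n t) \<longlonglongrightarrow> 1"
      unfolding has_bochner_integral_integral_eq[OF bq] by simp
    show ?thesis
      by (rule has_bochner_integral_monotone_convergence[OF m1 m2 m3 m4]) simp
  qed
  have "cauchy_transform (density lborel (\<lambda>t. ennreal (g t))) z = H z" if "Im z > 0" for z
    unfolding cauchy_transform_def
    using has_bochner_integral_integral_eq[OF bi[OF that]] g0
    by (subst integral_density) auto
  then show ?thesis
    using real_distribution_density[OF mass g0] unfolding H_def by blast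
qed

text \<open>The shifts by \<open>e n\<close> are transforms of measures \<open>\<rho> n\<close>, and
  tightness provides a weak limit along a subsequence. Its transform is \<open>G\<close> because the
  resolvent is bounded and continuous in \<open>t\<close> and \<open>G\<close> is continuous at
  \<open>z\<close>.\<close>

lemma cauchy_transform_representation:
  assumes hol: "G holomorphic_on {z. Im z > 0}"
    and neg: "\<And>z. Im z > 0 \<Longrightarrow> Im (G z) \<le> 0"
    and asy: "\<And>e. e > 0 \<Longrightarrow> \<exists>C. \<forall>z. Im z \<ge> e \<longrightarrow> norm (z * G z - 1) \<le> C / Im z"
  shows "\<exists>\<rho>. real_distribution \<rho> \<and> (\<forall>z. Im z > 0 \<longrightarrow> cauchy_transform \<rho> z = G z)"
proof -
  define e where "e n = 1 / real (Suc n)" for n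
  have e: "e n > 0" "e n \<le> 1" for n by (auto simp: e_def)
  have "\<exists>\<rho>. real_distribution \<rho> \<and>
    (\<forall>z. Im z > 0 \<longrightarrow> cauchy_transform \<rho> z = G (z + \<i> * of_real (e n)))" for n
  proof -
    obtain C where C: "\<forall>z. Im z \<ge> e n \<longrightarrow> norm (z * G z - 1) \<le> C / Im z"
      using asy[OF e(1), of n] by blast
    show ?thesis
      by (rule cauchy_transform_shift_representation[OF hol neg e(1), where C = C]) (use C in auto)
  qed
  then obtain \<rho> where \<rho>: "real_distribution (\<rho> n)"
    and G\<rho>: "Im z > 0 \<Longrightarrow> cauchy_transform (\<rho> n) z = G (z + \<i> * of_real (e n))" for n z
    by (metis (full_types))
  interpret \<rho>: real_distribution "\<rho> n" for n by (rule \<rho>)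
  \<comment> \<open>The constants from \<open>asy\<close> vary with the height. The one for heights
    at least 1 serves all shifts at once, since \<open>e n \<le> 1\<close>, and makes the tail bound
    uniform in \<open>n\<close>.\<close>
  obtain C where C: "\<And>z. Im z \<ge> 1 \<Longrightarrow> norm (z * G z - 1) \<le> C / Im z"
    using asy[of 1] by auto
  have "tight \<rho>"
    unfolding tight_def
  proof (intro conjI allI impI)
    fix \<epsilon> :: real assume "\<epsilon> > 0"
    define y where "y = max 1 (2 * (\<bar>C\<bar> + 1) / \<epsilon> + 1)"
    have y: "y \<ge> 1" and "2 * (\<bar>C\<bar> + 1) / \<epsilon> < y" by (auto simp: y_def)
    then have ye: "2 * ((\<bar>C\<bar> + 1) / y) < \<epsilon>" using \<open>\<epsilon> > 0\<close> by (simp add: field_simps)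
    have "measure (\<rho> n) {- y<..y} > 1 - \<epsilon>" for n
    proof -
      let ?z = "\<i> * complex_of_real y"
      have "norm (?z * cauchy_transform (\<rho> n) ?z - 1) \<le> (C + e n) / y"
        using norm_shift_estimate[OF _ e(1) C, of ?z n] y e(1)[of n] by (simp add: G\<rho>)
      also have "\<dots> \<le> (\<bar>C\<bar> + 1) / y"
        using e(2)[of n] y by (intro divide_right_mono add_mono) auto
      finally have "measure (\<rho> n) {t. y \<le> \<bar>t\<bar>} < \<epsilon>"
        using \<rho>.prob_abs_ge_le_cauchy_transform[of y n] y ye by linarith
      moreover have "1 - measure (\<rho> n) {- y<..y} \<le> measure (\<rho> n) {t. y \<le> \<bar>t\<bar>}"
        using \<rho>.prob_compl[of "{- y<..y}" n]
          \<rho>.finite_measure_mono[of "UNIV - {- y<..y}" "{t. y \<le> \<bar>t\<bar>}" n]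
        by (force simp: abs_le_iff)
      ultimately show ?thesis by simp
    qed
    moreover have "- y < y" using y by simp
    ultimately show "\<exists>a b. a < b \<and> (\<forall>n. 1 - \<epsilon> < measure (\<rho> n) {a<..b})" by blast
  qed (rule \<rho>)
  from tight_imp_convergent_subsubsequence[OF this strict_mono_id] obtain r M
    where r: "strict_mono (r :: nat \<Rightarrow> nat)" and M: "real_distribution M"
      and conv: "weak_conv_m (\<lambda>n. \<rho> (r n)) M" by (auto simp: o_def)
  interpret M: real_distribution M by fact
  have "cauchy_transform M z = G z" if z: "Im z > 0" for z
  proof (rule LIMSEQ_unique)
    have isc: "isCont (\<lambda>t. 1 / (z - complex_of_real t)) x" for x
      using diff_of_real_nonzero[OF z, of x] by (intro continuous_intros) auto
    show "(\<lambda>n. cauchy_transform (\<rho> (r n)) z) \<longlonglongrightarrow> cauchy_transform M z"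
      unfolding cauchy_transform_def
      by (rule weak_conv_imp_integral_bdd_continuous_conv[OF \<rho> M conv isc norm_resolvent_le[OF z]])
    have "isCont G z"
      using holomorphic_on_imp_continuous_on[OF hol] z
      by (subst (asm) continuous_on_eq_continuous_at[OF open_halfspace_Im_gt]) blast
    moreover have "(\<lambda>n. z + \<i> * of_real (e (r n))) \<longlonglongrightarrow> z + \<i> * of_real 0"
    proof (intro tendsto_intros)
      show "(\<lambda>n. e (r n)) \<longlonglongrightarrow> 0"
        using LIMSEQ_subseq_LIMSEQ[OF LIMSEQ_Suc[OF lim_const_over_n[of "1::real"]] r]
        unfolding e_def o_def of_nat_Suc by simp
    qed
    ultimately have "(\<lambda>n. G (z + \<i> * of_real (e (r n)))) \<longlonglongrightarrow> G z"
      using isCont_tendsto_compose[of z G] by simp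
    then show "(\<lambda>n. cauchy_transform (\<rho> (r n)) z) \<longlonglongrightarrow> G z"
      using z by (simp add: G\<rho>)
  qed
  with M show ?thesis by blast
qed

section \<open>Second moments\<close>

context real_distribution
begin

text \<open>Subtracting \<open>t\<close> from \<open>z * t / (z - t)\<close> leaves
  \<open>t^2 / (z - t)\<close>, so the first-order remainder formula extends exactly to second
  order.\<close>

lemma cauchy_transform_second_remainder:
  assumes z: "Im z > 0" and I2: "integrable M (\<lambda>x. x\<^sup>2)"
  shows "z * (z * (z * cauchy_transform M z - 1) - of_real (expectation (\<lambda>x. x)))
    = (LINT t|M. of_real (t\<^sup>2) * (z / (z - of_real t)))"
proof -
  have I1: "integrable M (\<lambda>x. x)" by (rule square_integrable_imp_integrable[OF _ I2]) simp
  have "z * (z * cauchy_transform M z - 1) = (LINT t|M. z * (of_real t / (z - of_real t)))"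
    unfolding cauchy_transform_remainder(2)[OF z I1] by (simp only: integral_mult_right_zero)
  moreover have "of_real (expectation (\<lambda>x. x)) = (LINT t|M. complex_of_real t)" by simp
  ultimately have "z * (z * cauchy_transform M z - 1) - of_real (expectation (\<lambda>x. x))
      = (LINT t|M. z * (of_real t / (z - of_real t)) - complex_of_real t)"
    using cauchy_transform_remainder(1)[OF z I1] I1
    by (simp only: Bochner_Integration.integral_diff integrable_mult_right integrable_of_real)
  then have "z * (z * (z * cauchy_transform M z - 1) - of_real (expectation (\<lambda>x. x)))
      = (LINT t|M. z * (z * (of_real t / (z - of_real t)) - complex_of_real t))"
    by (simp only: integral_mult_right_zero)
  also have "\<dots> = (LINT t|M. of_real (t\<^sup>2) * (z / (z - of_real t)))"
  proof (rule Bochner_Integration.integral_cong[OF refl])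
    fix t show "z * (z * (of_real t / (z - of_real t)) - complex_of_real t) = of_real (t\<^sup>2) * (z / (z - of_real t))"
      using diff_of_real_nonzero[OF z, of t] by (simp add: field_simps power2_eq_square)
  qed
  finally show ?thesis .
qed

text \<open>The bound \<open>norm (w n) \<le> K * Im (w n)\<close> makes the approach to infinity
  nontangential, so \<open>w n / (w n - t)\<close> has modulus at most \<open>K\<close> and
  \<open>K * t^2\<close> dominates. Such generality is called for because reciprocal transforms move
  points off the imaginary axis.\<close>

lemma tendsto_second_moment:
  fixes w :: "nat \<Rightarrow> complex"
  assumes w: "\<And>n. Im (w n) > 0" "\<And>n. norm (w n) \<le> K * Im (w n)" "filterlim w at_infinity sequentially"
    and I2: "integrable M (\<lambda>x. x\<^sup>2)"
  shows "(\<lambda>n. w n * (w n * (w n * cauchy_transform M (w n) - 1) - of_real (expectation (\<lambda>x. x))))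
    \<longlonglongrightarrow> of_real (expectation (\<lambda>x. x\<^sup>2))"
proof -
  have "(\<lambda>n. LINT t|M. complex_of_real (t\<^sup>2) * (w n / (w n - of_real t))) \<longlonglongrightarrow> (LINT t|M. complex_of_real (t\<^sup>2))"
  proof (rule integral_dominated_convergence[where w = "\<lambda>t. K * t\<^sup>2"])
    show "integrable M (\<lambda>t. K * t\<^sup>2)" using I2 by simp
    show "AE t in M. norm (complex_of_real (t\<^sup>2) * (w n / (w n - of_real t))) \<le> K * t\<^sup>2" for n
    proof (rule AE_I2)
      fix t
      have "norm (w n) * norm (1 / (w n - complex_of_real t)) \<le> norm (w n) * (1 / Im (w n))"
        by (intro mult_left_mono norm_resolvent_le w) simp
      also have "\<dots> \<le> K" using w(1,2)[of n] by (simp add: pos_divide_le_eq)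
      finally have "norm (w n / (w n - of_real t)) \<le> K" by (simp add: norm_divide)
      then have "t\<^sup>2 * norm (w n / (w n - of_real t)) \<le> t\<^sup>2 * K" by (intro mult_left_mono) auto
      then show "norm (complex_of_real (t\<^sup>2) * (w n / (w n - of_real t))) \<le> K * t\<^sup>2"
        unfolding norm_mult norm_of_real by (simp add: mult.commute)
    qed
    show "AE t in M. (\<lambda>n. complex_of_real (t\<^sup>2) * (w n / (w n - of_real t))) \<longlonglongrightarrow> complex_of_real (t\<^sup>2)"
    proof (rule AE_I2)
      fix t
      have nz: "w n - of_real t \<noteq> 0" for n by (rule diff_of_real_nonzero[OF w(1)])
      have eq: "w n / (w n - of_real t) = 1 + of_real t / (w n - of_real t)" for n
        using nz[of n] by (simp add: field_simps)
      have "filterlim (\<lambda>n. w n + - complex_of_real t) at_infinity sequentially"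
        by (rule tendsto_add_filterlim_at_infinity'[OF w(3) tendsto_const])
      then have "(\<lambda>n. of_real t / (w n - complex_of_real t)) \<longlonglongrightarrow> 0"
        by (intro tendsto_divide_0[OF tendsto_const]) simp
      then have "(\<lambda>n. w n / (w n - of_real t)) \<longlonglongrightarrow> 1 + 0"
        unfolding eq by (intro tendsto_intros)
      then show "(\<lambda>n. complex_of_real (t\<^sup>2) * (w n / (w n - of_real t))) \<longlonglongrightarrow> complex_of_real (t\<^sup>2)"
        using tendsto_mult[OF tendsto_const] by fastforce
    qed
  qed auto
  moreover have "(LINT t|M. complex_of_real (t\<^sup>2)) = of_real (expectation (\<lambda>x. x\<^sup>2))"
    by (rule integral_complex_of_real)
  ultimately show ?thesis by (simp only: cauchy_transform_second_remainder[OF w(1) I2])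
qed

text \<open>A converse to \<open>tendsto_second_moment\<close>, with no moments assumed. On the
  imaginary axis the term with \<open>m\<close> is purely imaginary, so the real parts are integrals
  of \<open>t^2\<close> against kernels increasing to 1, and monotone convergence produces the
  second moment.\<close>

lemma moments_from_asymptotics:
  fixes m s :: real
  defines "z \<equiv> \<lambda>n. \<i> * complex_of_real (real (Suc n))"
  assumes lim: "(\<lambda>n. z n * (z n * (z n * cauchy_transform M (z n) - 1) - of_real m)) \<longlonglongrightarrow> of_real s"
  shows "integrable M (\<lambda>x. x\<^sup>2)" and "expectation (\<lambda>x. x) = m" and "expectation (\<lambda>x. x\<^sup>2) = s"
proof -
  have z: "Im (z n) > 0" "norm (z n) = real (Suc n)" "norm (z n) \<le> 1 * Im (z n)" "z n \<noteq> 0" for n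
    by (auto simp: z_def norm_mult simp del: of_nat_Suc)
  have zinf: "filterlim z at_infinity sequentially"
    unfolding filterlim_at_infinity_conv_norm_at_top z(2)
    by (rule filterlim_compose[OF filterlim_real_sequentially filterlim_Suc])
  let ?q = "\<lambda>n t. (real (Suc n))\<^sup>2 / (t\<^sup>2 + (real (Suc n))\<^sup>2)"
  have pos: "t\<^sup>2 + (real (Suc n))\<^sup>2 > 0" for t n by (simp add: add_nonneg_pos)
  have q: "?q n t = 1 - t\<^sup>2 / (t\<^sup>2 + (real (Suc n))\<^sup>2)" for n t
    by (rule fraction_of_sum_eq[OF pos])
  have Req: "Re (z n * z n * (z n * (1 / (z n - of_real t)) - 1)) = t\<^sup>2 * ?q n t" for n t
  proof -
    have "z n * z n = of_real (- ((real (Suc n))\<^sup>2))" by (simp add: z_def power2_eq_square algebra_simps)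
    moreover have "Re (z n * (1 / (z n - of_real t))) = ?q n t"
      unfolding z_def by (rule Re_resolvent_imaginary) simp
    ultimately have "Re (z n * z n * (z n * (1 / (z n - of_real t)) - 1)) = - ((real (Suc n))\<^sup>2) * (?q n t - 1)"
      by (simp only: times_complex.sel minus_complex.sel one_complex.sel Re_complex_of_real Im_complex_of_real
          mult_zero_left diff_zero)
    also have "?q n t - 1 = - (t\<^sup>2 / (t\<^sup>2 + (real (Suc n))\<^sup>2))"
      unfolding q by simp
    finally show ?thesis by simp
  qed
  have Iq: "integrable M (\<lambda>t. z n * z n * (z n * (1 / (z n - of_real t)) - 1))" for n
    by (intro integrable_mult_right Bochner_Integration.integrable_diff integrable_const
        integrable_resolvent[OF z(1)])
  have Eq: "Re (z n * (z n * (z n * cauchy_transform M (z n) - 1) - of_real m)) = (LINT t|M. t\<^sup>2 * ?q n t)" for n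
  proof -
    have "(LINT t|M. z n * z n * (z n * (1 / (z n - of_real t)) - 1)) = z n * z n * (z n * cauchy_transform M (z n) - 1)"
      using integrable_mult_right[OF integrable_resolvent[OF z(1)], of "z n" n]
      by (simp only: cauchy_transform_def integral_mult_right_zero Bochner_Integration.integral_diff integrable_const)
         (simp add: prob_space[simplified])
    moreover have "z n * (z n * (z n * cauchy_transform M (z n) - 1) - of_real m)
        = z n * z n * (z n * cauchy_transform M (z n) - 1) - z n * of_real m" by (simp add: algebra_simps)
    moreover have "Re (z n * of_real m) = 0" by (simp add: z_def)
    moreover have "Re (LINT t|M. z n * z n * (z n * (1 / (z n - of_real t)) - 1)) = (LINT t|M. t\<^sup>2 * ?q n t)"
      unfolding Req[symmetric] by (rule integral_Re[symmetric, OF Iq])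
    ultimately show ?thesis by (simp only: minus_complex.sel diff_zero)
  qed
  have m1: "integrable M (\<lambda>t. t\<^sup>2 * ?q n t)" for n
    unfolding Req[symmetric] by (rule integrable_Re[OF Iq])
  have "mono (\<lambda>n. ?q n t)" for t
    unfolding mono_def q
  proof (intro allI impI diff_left_mono divide_left_mono add_left_mono power_mono mult_pos_pos)
  qed (auto simp: add_nonneg_pos)
  then have m2: "AE t in M. mono (\<lambda>n. t\<^sup>2 * ?q n t)"
    unfolding mono_def by (intro AE_I2) (meson mult_left_mono zero_le_power2)
  have "(\<lambda>n. ?q n t) \<longlonglongrightarrow> 1" for t by real_asymp
  then have m3': "(\<lambda>n. t\<^sup>2 * ?q n t) \<longlonglongrightarrow> t\<^sup>2" for t
    using tendsto_mult[OF tendsto_const[of "t\<^sup>2"]] by fastforce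
  have m3: "AE t in M. (\<lambda>n. t\<^sup>2 * ?q n t) \<longlonglongrightarrow> t\<^sup>2"
    by (intro AE_I2 m3')
  have m4: "(\<lambda>n. LINT t|M. t\<^sup>2 * ?q n t) \<longlonglongrightarrow> s"
    using tendsto_Re[OF lim] unfolding Eq by simp
  have "has_bochner_integral M (\<lambda>t. t\<^sup>2) s"
    by (rule has_bochner_integral_monotone_convergence[OF m1 m2 m3 m4]) simp
  then show I2: "integrable M (\<lambda>x. x\<^sup>2)" and s: "expectation (\<lambda>x. x\<^sup>2) = s"
    by (auto simp: has_bochner_integral_iff)
  \<comment> \<open>The expansions with \<open>m\<close> and with the true mean now both converge.
    They differ by \<open>z n\<close> times the gap between the two, so dividing by
    \<open>z n\<close> forces the gap to vanish.\<close>
  have "(\<lambda>n. (z n * (z n * (z n * cauchy_transform M (z n) - 1) - of_real m) -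
        z n * (z n * (z n * cauchy_transform M (z n) - 1) - of_real (expectation (\<lambda>x. x)))) / z n) \<longlonglongrightarrow> 0"
    by (rule tendsto_divide_0[OF tendsto_diff[OF lim tendsto_second_moment[OF z(1,3) zinf I2]] zinf])
  moreover have "(z n * (z n * (z n * cauchy_transform M (z n) - 1) - of_real m) -
        z n * (z n * (z n * cauchy_transform M (z n) - 1) - of_real (expectation (\<lambda>x. x)))) / z n
        = of_real (expectation (\<lambda>x. x) - m)" for n
    using z(4)[of n] by (simp add: field_simps)
  ultimately have "(\<lambda>n::nat. complex_of_real (expectation (\<lambda>x. x) - m)) \<longlonglongrightarrow> 0" by simp
  then show "expectation (\<lambda>x. x) = m" by (simp only: LIMSEQ_const_iff) simp
qed

end

section \<open>Monotone convolution\<close>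

text \<open>The reciprocal determines the transform, so \<open>cauchy_transform_unique\<close>
  supplies the uniqueness that \<open>THE\<close> demands.\<close>

lemma monotone_convolution_eqI:
  assumes \<rho>: "real_distribution \<rho>"
    and eq: "\<And>z. Im z > 0 \<Longrightarrow> reciprocal_cauchy_transform \<rho> z
      = reciprocal_cauchy_transform \<mu> (reciprocal_cauchy_transform \<nu> z)"
  shows "\<mu> \<triangleright> \<nu> = \<rho>"
  unfolding monotone_convolution_def
proof (rule the_equality)
  fix \<sigma> assume \<sigma>: "real_distribution \<sigma> \<and> (\<forall>z. Im z > 0 \<longrightarrow> reciprocal_cauchy_transform \<sigma> z
      = reciprocal_cauchy_transform \<mu> (reciprocal_cauchy_transform \<nu> z))"
  show "\<sigma> = \<rho>"
  proof (rule cauchy_transform_unique)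
    fix z assume "Im z > 0"
    then have "1 / cauchy_transform \<sigma> z = 1 / cauchy_transform \<rho> z"
      using \<sigma> eq by (simp add: reciprocal_cauchy_transform_def)
    then show "cauchy_transform \<sigma> z = cauchy_transform \<rho> z"
      by (metis div_by_1 divide_divide_eq_right mult_1)
  qed (use \<sigma> \<rho> in auto)
qed (use \<rho> eq in auto)

text \<open>\<open>cauchy_transform_representation\<close> is applied to the composition: that
  reciprocal transforms do not lower imaginary parts gives holomorphy and sign, and the first
  moments give the decay.\<close>

lemma monotone_convolution_exists:
  assumes \<mu>: "real_distribution \<mu>" "integrable \<mu> (\<lambda>x. x)"
    and \<nu>: "real_distribution \<nu>" "integrable \<nu> (\<lambda>x. x)"
  shows "real_distribution (\<mu> \<triangleright> \<nu>)"
    and "\<And>z. Im z > 0 \<Longrightarrow> cauchy_transform (\<mu> \<triangleright> \<nu>) z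
      = cauchy_transform \<mu> (reciprocal_cauchy_transform \<nu> z)"
proof -
  interpret \<mu>: real_distribution \<mu> by fact
  interpret \<nu>: real_distribution \<nu> by fact
  let ?F = "reciprocal_cauchy_transform \<nu>"
  let ?G = "\<lambda>z. cauchy_transform \<mu> (?F z)"
  have F: "Im (?F z) \<ge> Im z" if "Im z > 0" for z
    by (rule \<nu>.Im_reciprocal_cauchy_transform_ge[OF that])
  have "\<exists>\<rho>. real_distribution \<rho> \<and> (\<forall>z. Im z > 0 \<longrightarrow> cauchy_transform \<rho> z = ?G z)"
  proof (rule cauchy_transform_representation)
    have "?F holomorphic_on {z. Im z > 0}"
      unfolding reciprocal_cauchy_transform_def
      using \<nu>.cauchy_transform_holomorphic \<nu>.cauchy_transform_nonzero by (intro holomorphic_intros) auto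
    then show "?G holomorphic_on {z. Im z > 0}"
      by (rule holomorphic_on_compose_gen[OF _ \<mu>.cauchy_transform_holomorphic, unfolded o_def])
         (use F in \<open>force\<close>)
    show "Im (?G z) \<le> 0" if "Im z > 0" for z
      using \<mu>.Im_cauchy_transform_neg[of "?F z"] F[OF that] that by simp
    fix e :: real assume e: "e > 0"
    define E where "E = (LINT t|\<mu>. \<bar>t\<bar>)"
    define E' where "E' = (LINT t|\<nu>. \<bar>t\<bar>)"
    have E: "E \<ge> 0" "E' \<ge> 0" by (auto simp: E_def E'_def)
    have "norm (z * ?G z - 1) \<le> ((1 + E' / e) * E + E') / Im z" if z: "Im z \<ge> e" for z
    proof -
      have z0: "Im z > 0" using z e by simp
      define u where "u = cauchy_transform \<nu> z"
      define w where "w = ?F z"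
      have w: "w = 1 / u" and u: "u \<noteq> 0" and Imw: "Im w \<ge> Im z"
        using \<nu>.cauchy_transform_nonzero[OF z0] F[OF z0] by (simp_all add: w_def u_def reciprocal_cauchy_transform_def)
      have zu: "norm (z * u - 1) \<le> E' / Im z"
        unfolding u_def E'_def by (rule \<nu>.cauchy_transform_remainder(3)[OF z0 \<nu>(2)])
      have "E' / Im z \<le> E' / e" using E z e by (intro divide_left_mono) auto
      then have zu1: "norm (z * u) \<le> 1 + E' / e"
        using zu norm_triangle_ineq[of "z * u - 1" 1] by simp
      have "norm (w * cauchy_transform \<mu> w - 1) \<le> E / Im w"
        unfolding E_def using Imw z0 by (intro \<mu>.cauchy_transform_remainder(3)[OF _ \<mu>(2)]) auto
      also have "\<dots> \<le> E / Im z" using E Imw z0 by (intro divide_left_mono) auto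
      finally have ww: "norm (w * cauchy_transform \<mu> w - 1) \<le> E / Im z" .
      \<comment> \<open>Because \<open>w = 1 / u\<close>, \<open>z\<close> equals
        \<open>(z * u) * w\<close>; the error of the composition splits into the errors of the two
        transforms.\<close>
      have "z * cauchy_transform \<mu> w - 1 = (z * u) * (w * cauchy_transform \<mu> w - 1) + (z * u - 1)"
        using u by (simp add: w field_simps)
      also have "norm \<dots> \<le> norm (z * u) * norm (w * cauchy_transform \<mu> w - 1) + norm (z * u - 1)"
        by (intro order_trans[OF norm_triangle_ineq]) (simp only: norm_mult)
      also have "\<dots> \<le> (1 + E' / e) * (E / Im z) + E' / Im z"
        by (intro add_mono mult_mono zu1 ww zu) (use E e in auto)
      finally show ?thesis unfolding w_def by (simp add: add_divide_distrib)
    qed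
    then show "\<exists>C. \<forall>z. e \<le> Im z \<longrightarrow> norm (z * ?G z - 1) \<le> C / Im z" by blast
  qed
  then obtain \<rho> where \<rho>: "real_distribution \<rho>" "\<And>z. Im z > 0 \<Longrightarrow> cauchy_transform \<rho> z = ?G z" by blast
  have "\<mu> \<triangleright> \<nu> = \<rho>"
    using \<rho> by (intro monotone_convolution_eqI) (auto simp: reciprocal_cauchy_transform_def[of \<rho>] reciprocal_cauchy_transform_def[of \<mu>])
  then show "real_distribution (\<mu> \<triangleright> \<nu>)" "\<And>z. Im z > 0 \<Longrightarrow> cauchy_transform (\<mu> \<triangleright> \<nu>) z = ?G z"
    using \<rho> by auto
qed

text \<open>Expanding the composition at \<open>\<i> * (n + 1)\<close> gives mean
  \<open>m + m'\<close> and second moment \<open>s' + 2 * m * m' + s\<close>, as for a sum of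
  independent variables; the cross term cancels in the variance.\<close>

lemma monotone_convolution_variance:
  assumes \<mu>: "real_distribution \<mu>" "integrable \<mu> (\<lambda>x. x\<^sup>2)"
    and \<nu>: "real_distribution \<nu>" "integrable \<nu> (\<lambda>x. x\<^sup>2)"
  shows "integrable (\<mu> \<triangleright> \<nu>) (\<lambda>x. x\<^sup>2)"
    and "prob_space.variance (\<mu> \<triangleright> \<nu>) (\<lambda>x. x)
      = prob_space.variance \<mu> (\<lambda>x. x) + prob_space.variance \<nu> (\<lambda>x. x)"
proof -
  interpret \<mu>: real_distribution \<mu> by fact
  interpret \<nu>: real_distribution \<nu> by fact
  have \<mu>1: "integrable \<mu> (\<lambda>x. x)" by (rule \<mu>.square_integrable_imp_integrable[OF _ \<mu>(2)]) simp
  have \<nu>1: "integrable \<nu> (\<lambda>x. x)" by (rule \<nu>.square_integrable_imp_integrable[OF _ \<nu>(2)]) simp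
  note ex = monotone_convolution_exists[OF \<mu>(1) \<mu>1 \<nu>(1) \<nu>1]
  interpret \<rho>: real_distribution "\<mu> \<triangleright> \<nu>" by (rule ex(1))
  define m where "m = \<mu>.expectation (\<lambda>x. x)"
  define s where "s = \<mu>.expectation (\<lambda>x. x\<^sup>2)"
  define m' where "m' = \<nu>.expectation (\<lambda>x. x)"
  define s' where "s' = \<nu>.expectation (\<lambda>x. x\<^sup>2)"
  define z where "z n = \<i> * complex_of_real (real (Suc n))" for n
  define u where "u n = cauchy_transform \<nu> (z n)" for n
  define w where "w n = reciprocal_cauchy_transform \<nu> (z n)" for n
  have z: "Im (z n) > 0" "norm (z n) = Im (z n)" "norm (z n) = real (Suc n)" "z n \<noteq> 0" for n
    by (auto simp: z_def norm_mult simp del: of_nat_Suc)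
  have zinf: "filterlim z at_infinity sequentially"
    unfolding filterlim_at_infinity_conv_norm_at_top z(3)
    by (rule filterlim_compose[OF filterlim_real_sequentially filterlim_Suc])
  have u: "u n \<noteq> 0" and w: "w n = 1 / u n" and Imw: "Im (w n) \<ge> Im (z n)" for n
    using \<nu>.cauchy_transform_nonzero[OF z(1)] \<nu>.Im_reciprocal_cauchy_transform_ge[OF z(1)]
    by (auto simp: u_def w_def reciprocal_cauchy_transform_def)
  define S' where "S' n = z n * (z n * (z n * u n - 1) - of_real m')" for n
  have S': "S' \<longlonglongrightarrow> of_real s'"
    unfolding S'_def u_def m'_def s'_def
    by (rule \<nu>.tendsto_second_moment[OF z(1) _ zinf \<nu>(2), of 1]) (simp add: z(2))
  have "(\<lambda>n. S' n / z n + of_real m') \<longlonglongrightarrow> 0 + of_real m'"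
    by (intro tendsto_add tendsto_const tendsto_divide_0[OF S' zinf])
  moreover have "S' n / z n + of_real m' = z n * (z n * u n - 1)" for n
    using z(4)[of n] by (simp add: S'_def)
  ultimately have lim1: "(\<lambda>n. z n * (z n * u n - 1)) \<longlonglongrightarrow> of_real m'" by simp
  have "(\<lambda>n. z n * (z n * u n - 1) / z n + 1) \<longlonglongrightarrow> 0 + 1"
    by (intro tendsto_add tendsto_const tendsto_divide_0[OF lim1 zinf])
  moreover have "z n * (z n * u n - 1) / z n + 1 = z n * u n" for n
    using z(4)[of n] by simp
  ultimately have lim0: "(\<lambda>n. z n * u n) \<longlonglongrightarrow> 1" by simp
  have "(\<lambda>n. 1 / (z n * u n)) \<longlonglongrightarrow> 1 / 1" by (intro tendsto_divide lim0 tendsto_const) simp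
  then have "Bseq (\<lambda>n. 1 / (z n * u n))" by (rule convergent_imp_Bseq[OF convergentI])
  \<comment> \<open>\<open>1 / (z n * u n)\<close> is the ratio \<open>w n / z n\<close>. Its
    boundedness and \<open>Im (w n) \<ge> Im (z n)\<close> give the nontangential condition of
    \<open>tendsto_second_moment\<close> for \<open>w\<close>.\<close>
  then obtain K where K: "\<And>n. norm (1 / (z n * u n)) \<le> K" by (auto simp: Bseq_def)
  have wK: "norm (w n) \<le> K * Im (w n)" for n
  proof -
    have "norm (w n) = norm (1 / (z n * u n)) * norm (z n)"
      using z(4)[of n] by (simp add: w norm_divide norm_mult)
    also have "\<dots> \<le> K * Im (w n)"
      using K[of n] Imw[of n] z(1,2)[of n] by (intro mult_mono) (auto intro: order_trans[OF norm_ge_zero])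
    finally show ?thesis .
  qed
  have Imw0: "Im (w n) > 0" for n using Imw[of n] z(1)[of n] by simp
  have winf: "filterlim w at_infinity sequentially"
  proof -
    have le: "norm (z n) \<le> norm (w n)" for n
      using Imw[of n] z(2)[of n] abs_Im_le_cmod[of "w n"] by linarith
    show ?thesis
      unfolding filterlim_at_infinity_conv_norm_at_top
      by (rule filterlim_at_top_mono[OF zinf[unfolded filterlim_at_infinity_conv_norm_at_top]])
         (intro always_eventually allI le)
  qed
  define S where "S n = w n * (w n * (w n * cauchy_transform \<mu> (w n) - 1) - of_real m)" for n
  have S: "S \<longlonglongrightarrow> of_real s"
    unfolding S_def m_def s_def by (rule \<mu>.tendsto_second_moment[OF Imw0 wK winf \<mu>(2)])
  \<comment> \<open>Solving the definition of \<open>S n\<close> for the transform of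
    \<open>\<mu>\<close> at \<open>w n\<close> gives \<open>u + m * u^2 + S * u^3\<close>.
    Multiplying by \<open>z^3\<close> and regrouping leaves only quantities whose limits are
    known.\<close>
  have eq: "z n * (z n * (z n * cauchy_transform (\<mu> \<triangleright> \<nu>) (z n) - 1) - of_real (m + m'))
    = S' n + of_real m * ((z n * u n + 1) * (z n * (z n * u n - 1))) + S n * (z n * u n) ^ 3" for n
  proof -
    have "cauchy_transform (\<mu> \<triangleright> \<nu>) (z n) = cauchy_transform \<mu> (w n)"
      unfolding w_def by (rule ex(2)[OF z(1)])
    moreover have "S n * (z n * u n) ^ 3 = z n ^ 3 * (cauchy_transform \<mu> (w n) - u n - of_real m * (u n)\<^sup>2)"
      using u[of n] by (simp add: S_def w field_simps power2_eq_square power3_eq_cube)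
    ultimately show ?thesis
      by (simp add: S'_def algebra_simps power2_eq_square power3_eq_cube)
  qed
  have "(\<lambda>n. S' n + of_real m * ((z n * u n + 1) * (z n * (z n * u n - 1))) + S n * (z n * u n) ^ 3)
    \<longlonglongrightarrow> of_real s' + of_real m * ((1 + 1) * of_real m') + of_real s * 1 ^ 3"
    by (intro tendsto_intros S S' lim0 lim1)
  then have "(\<lambda>n. z n * (z n * (z n * cauchy_transform (\<mu> \<triangleright> \<nu>) (z n) - 1) - of_real (m + m')))
    \<longlonglongrightarrow> of_real (s' + 2 * m * m' + s)"
    unfolding eq by (simp add: mult.assoc mult.left_commute)
  note mom = \<rho>.moments_from_asymptotics[OF this[unfolded z_def]]
  show I: "integrable (\<mu> \<triangleright> \<nu>) (\<lambda>x. x\<^sup>2)" by (rule mom(1))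
  have I1: "integrable (\<mu> \<triangleright> \<nu>) (\<lambda>x. x)" by (rule \<rho>.square_integrable_imp_integrable[OF _ I]) simp
  show "\<rho>.variance (\<lambda>x. x) = \<mu>.variance (\<lambda>x. x) + \<nu>.variance (\<lambda>x. x)"
    unfolding \<rho>.variance_eq[OF I1 I] \<mu>.variance_eq[OF \<mu>1 \<mu>(2)] \<nu>.variance_eq[OF \<nu>1 \<nu>(2)]
    unfolding mom(2,3) m_def[symmetric] m'_def[symmetric] s_def[symmetric] s'_def[symmetric]
    by (simp add: power2_eq_square algebra_simps)
qed

section \<open>Iterated convolutions, Kronecker's lemma and the limit theorem\<close>

lemma finite_variance_imp_square_integrable:
  assumes "real_distribution \<mu>" "finite_variance \<mu>"
  shows "integrable \<mu> (\<lambda>x. x\<^sup>2)"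
proof -
  interpret real_distribution \<mu> by fact
  let ?m = "LINT y|\<mu>. y"
  have "integrable \<mu> (\<lambda>x. (x - ?m)\<^sup>2 + (2 * ?m * x - ?m\<^sup>2))"
    using assms(2) unfolding finite_variance_def
    by (intro Bochner_Integration.integrable_add Bochner_Integration.integrable_diff) auto
  then show ?thesis by (simp add: power2_eq_square algebra_simps)
qed

text \<open>The index is \<open>Suc n\<close> because the factors start at \<open>\<mu> 1\<close>.
  Square integrability is carried through the induction, as each new convolution requires it of its
  left factor.\<close>

lemma monotone_convolution_upto_variance:
  assumes \<mu>: "\<And>n. n \<ge> 1 \<Longrightarrow> real_distribution (\<mu> n)" "\<And>n. n \<ge> 1 \<Longrightarrow> finite_variance (\<mu> n)"
  shows "real_distribution (monotone_convolution_upto \<mu> (Suc n)) \<and>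
    integrable (monotone_convolution_upto \<mu> (Suc n)) (\<lambda>x. x\<^sup>2) \<and>
    prob_space.variance (monotone_convolution_upto \<mu> (Suc n)) (\<lambda>x. x)
      = (\<Sum>k\<le>n. prob_space.variance (\<mu> (Suc k)) (\<lambda>x. x))"
proof (induction n)
  case 0
  then show ?case using \<mu> finite_variance_imp_square_integrable by simp
next
  case (Suc n)
  let ?M = "monotone_convolution_upto \<mu> (Suc n)" and ?N = "\<mu> (Suc (Suc n))"
  have M: "real_distribution ?M" "integrable ?M (\<lambda>x. x\<^sup>2)" using Suc by auto
  have N: "real_distribution ?N" "integrable ?N (\<lambda>x. x\<^sup>2)"
    using \<mu> finite_variance_imp_square_integrable by auto
  interpret M: real_distribution ?M by fact
  interpret N: real_distribution ?N by fact
  have "real_distribution (?M \<triangleright> ?N)"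
    by (rule monotone_convolution_exists(1)[OF M(1) M.square_integrable_imp_integrable[OF _ M(2)]
          N(1) N.square_integrable_imp_integrable[OF _ N(2)]]) auto
  then show ?case
    using monotone_convolution_variance[OF M N] Suc by simp
qed

text \<open>Tannery's theorem replaces summation by parts: the quotient is a series over
  \<open>k\<close> whose terms tend to 0 as \<open>b n\<close> grows and, by monotonicity of
  \<open>b\<close>, are dominated by \<open>v k / (b k)^2\<close>.\<close>

lemma kronecker_squares:
  fixes v b :: "nat \<Rightarrow> real"
  assumes v: "\<And>k. v k \<ge> 0" and b0: "\<And>k. b k > 0" and b: "mono b" "filterlim b at_top sequentially"
    and sum: "summable (\<lambda>k. v k / (b k)\<^sup>2)"
  shows "(\<lambda>n. (\<Sum>k\<le>n. v k) / (b n)\<^sup>2) \<longlonglongrightarrow> 0"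
proof -
  let ?a = "\<lambda>k n. if k \<le> n then v k / (b n)\<^sup>2 else 0"
  have "((\<lambda>n. suminf (\<lambda>k. ?a k n)) \<longlongrightarrow> suminf (\<lambda>k. 0 :: real)) sequentially"
  proof (rule tannerys_theorem[THEN conjunct2, THEN conjunct2])
    show "(\<lambda>n. ?a k n) \<longlonglongrightarrow> 0" for k
    proof (rule Lim_null_comparison)
      show "\<forall>\<^sub>F n in sequentially. norm (?a k n) \<le> v k / (b n)\<^sup>2"
        using v b0 by (auto intro!: always_eventually)
      show "(\<lambda>n. v k / (b n)\<^sup>2) \<longlonglongrightarrow> 0"
        by (rule tendsto_divide_0[OF tendsto_const filterlim_at_top_imp_at_infinity])
           (rule filterlim_pow_at_top[OF _ b(2)], simp)
    qed
    have "norm (?a k n) \<le> v k / (b k)\<^sup>2" for k n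
    proof (cases "k \<le> n")
      case True
      then have "(b k)\<^sup>2 \<le> (b n)\<^sup>2" using monoD[OF b(1)] b0[of k] by (intro power_mono) auto
      then show ?thesis using v[of k] b0[of k] b0[of n] True by (auto intro!: divide_left_mono)
    qed (use v b0 in auto)
    then show "\<forall>\<^sub>F (k, n) in sequentially \<times>\<^sub>F sequentially. norm (?a k n) \<le> v k / (b k)\<^sup>2"
      by (auto intro!: always_eventually)
  qed (use sum in auto)
  moreover have "suminf (\<lambda>k. ?a k n) = (\<Sum>k\<le>n. v k) / (b n)\<^sup>2" for n
    by (subst suminf_finite[of "{..n}"]) (auto simp: sum_divide_distrib)
  ultimately show ?thesis by simp
qed

theorem theorem1p1:
  fixes \<mu> :: "nat \<Rightarrow> real measure" and b :: "nat \<Rightarrow> real"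
  assumes "\<And>n. n \<ge> 1 \<Longrightarrow> real_distribution (\<mu> n)"
    and "\<And>n. n \<ge> 1 \<Longrightarrow> finite_variance (\<mu> n)"
    and "0 < b 1"
    and "\<And>n. n \<ge> 1 \<Longrightarrow> b n < b (Suc n)"
    and "filterlim b at_top sequentially"
    and "summable (\<lambda>k. prob_space.variance (\<mu> (Suc k)) (\<lambda>x. x) / (b (Suc k))\<^sup>2)"
  shows "stable_sequence (\<lambda>n. dilation (1 / b n) (monotone_convolution_upto \<mu> n))"
proof -
  let ?M = "\<lambda>n. monotone_convolution_upto \<mu> n"
  let ?v = "\<lambda>k. prob_space.variance (\<mu> (Suc k)) (\<lambda>x. x)"
  \<comment> \<open>For \<open>n \<ge> 1\<close> this is the mean of the dilated measure, the centre
    for Chebyshev's inequality.\<close>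
  define a where "a n = (LINT x|?M n. x) / b n" for n
  note M = monotone_convolution_upto_variance[of \<mu>, OF assms(1,2)]
  have mono: "mono (\<lambda>n. b (Suc n))"
    by (rule incseq_SucI, rule less_imp_le, rule assms(4)) simp
  have b0: "b (Suc n) > 0" for n
    using monoD[OF mono, of 0 n] assms(3) by simp
  have v0: "?v k \<ge> 0" for k by simp
  have kron: "(\<lambda>n. (\<Sum>k\<le>n. ?v k) / (b (Suc n))\<^sup>2) \<longlonglongrightarrow> 0"
    by (rule kronecker_squares[OF v0 b0 mono filterlim_compose[OF assms(5) filterlim_Suc] assms(6)])
  have "(\<lambda>n. measure (dilation (1 / b n) (?M n)) {t. \<bar>t - a n\<bar> \<ge> \<epsilon>}) \<longlonglongrightarrow> 0" if \<epsilon>: "\<epsilon> > 0" for \<epsilon>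
  \<comment> \<open>Passing to \<open>Suc n\<close> leaves out index 0, since positivity of
    \<open>b\<close> and the variance formula are available from index 1 on.\<close>
  proof (rule LIMSEQ_imp_Suc, rule Lim_null_comparison)
    show "(\<lambda>n. (\<Sum>k\<le>n. ?v k) / (b (Suc n))\<^sup>2 / \<epsilon>\<^sup>2) \<longlonglongrightarrow> 0"
      using tendsto_divide[OF kron tendsto_const, of "\<epsilon>\<^sup>2"] \<epsilon> by simp
    show "\<forall>\<^sub>F n in sequentially. norm (measure (dilation (1 / b (Suc n)) (?M (Suc n)))
        {t. \<bar>t - a (Suc n)\<bar> \<ge> \<epsilon>}) \<le> (\<Sum>k\<le>n. ?v k) / (b (Suc n))\<^sup>2 / \<epsilon>\<^sup>2"
    proof (rule always_eventually, rule allI)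
      fix n
      interpret M: real_distribution "?M (Suc n)" using M by blast
      have "\<epsilon> \<le> \<bar>1 / b (Suc n) * x - a (Suc n)\<bar> \<longleftrightarrow> \<epsilon> * b (Suc n) \<le> \<bar>x - M.expectation (\<lambda>x. x)\<bar>" for x
      proof -
        have "1 / b (Suc n) * x - a (Suc n) = (x - M.expectation (\<lambda>x. x)) / b (Suc n)"
          by (simp add: a_def diff_divide_distrib)
        then show ?thesis using b0[of n] by (simp add: pos_le_divide_eq)
      qed
      then have "measure (dilation (1 / b (Suc n)) (?M (Suc n))) {t. \<bar>t - a (Suc n)\<bar> \<ge> \<epsilon>}
          = M.prob {x \<in> space (?M (Suc n)). \<epsilon> * b (Suc n) \<le> \<bar>x - M.expectation (\<lambda>x. x)\<bar>}"
        unfolding dilation_def by (subst measure_distr) (auto intro!: arg_cong[where f = M.prob])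
      also have "\<dots> \<le> M.variance (\<lambda>x. x) / (\<epsilon> * b (Suc n))\<^sup>2"
        using M[of n] b0[of n] \<epsilon> by (intro M.Chebyshev_inequality) auto
      also have "M.variance (\<lambda>x. x) = (\<Sum>k\<le>n. ?v k)" using M[of n] by blast
      finally show "norm (measure (dilation (1 / b (Suc n)) (?M (Suc n)))
        {t. \<bar>t - a (Suc n)\<bar> \<ge> \<epsilon>}) \<le> (\<Sum>k\<le>n. ?v k) / (b (Suc n))\<^sup>2 / \<epsilon>\<^sup>2"
        by (simp add: power_mult_distrib mult.commute)
    qed
  qed
  then show ?thesis unfolding stable_sequence_def by blast
qed

end
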